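(* Let $k\ge 2$ be an integer. The complex vector space spanned by the functions $B_{k,1},B_{k,2},\dots,B_{k,k}$ on the upper half-plane is $\Gamma_0(2)$-invariant; that is, for every $f$ in this span and every $\gamma=\begin{pmatrix}a&b\\c&d\end{pmatrix}\in\Gamma_0(2)$, the function $\tau\mapsto f\left(\frac{a\tau+b}{c\tau+d}\right)$ again lies in this span.
   Context: Let $\tau$ range over the complex upper half-plane, $q=e^{2\pi i\tau}$, and $q^{a}=e^{2\pi i a\tau}$ for rational $a$. For integers $k\ge 2$ and $j\in\{1,\dots,k\}$ set $$a_{k,j}=\frac{6j^2-12j-k+6}{24k},$$ and define the Andrews-Bressoud series $$B_{k,j}(q)=q^{a_{k,j}}\prod_{m\ge 1}\frac{(1-q^{2km})(1-q^{2km-k-j+1})(1-q^{2km-k+j-1})}{1-q^m},$$ regarded as a function of $\tau$. $\Gamma_0(2)$ is the group of matrices in $\mathrm{SL}_2(\mathbb{Z})$ whose lower-left entry is even. *)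

theory Defs
  imports "HOL-Analysis.Analysis" "HOL-Library.Function_Algebras"
begin

typedef uhp = "{z::complex. Im z > 0}"
  by (rule exI[of _ \<i>]) simp

definition uhp_scale :: "complex \<Rightarrow> (uhp \<Rightarrow> complex) \<Rightarrow> uhp \<Rightarrow> complex" where
  "uhp_scale c f = (\<lambda>\<tau>. c * f \<tau>)"

global_interpretation uhp_fun: vector_space uhp_scale
  by unfold_locales (auto simp: uhp_scale_def fun_eq_iff algebra_simps)

definition q_pow :: "rat \<Rightarrow> uhp \<Rightarrow> complex" where
  "q_pow a \<tau> = exp (2 * of_real pi * \<i> * of_rat a * Rep_uhp \<tau>)"

definition andrews_bressoud_exponent :: "nat \<Rightarrow> nat \<Rightarrow> rat" where
  "andrews_bressoud_exponent k j =
     (6 * of_nat j ^ 2 - 12 * of_nat j - of_nat k + 6) / (24 * of_nat k)"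

text \<open>The index \<open>n = 0, 1, \<dots>\<close> of the library's infinite product corresponds to \<open>m = n + 1\<close>;
  exponents are integers, so no subtraction is truncated.\<close>

definition andrews_bressoud :: "nat \<Rightarrow> nat \<Rightarrow> uhp \<Rightarrow> complex" where
  "andrews_bressoud k j \<tau> =
     (let q = exp (2 * of_real pi * \<i> * Rep_uhp \<tau>) in
      q_pow (andrews_bressoud_exponent k j) \<tau> *
      (\<Prod>n. let m = int n + 1 in
         (1 - q powi (2 * int k * m)) *
         (1 - q powi (2 * int k * m - int k - int j + 1)) *
         (1 - q powi (2 * int k * m - int k + int j - 1)) / (1 - q powi m)))"

definition Gamma0_2 :: "(int ^ 2 ^ 2) set" where
  "Gamma0_2 = {A. det A = 1 \<and> even (A $ 2 $ 1)}"

text \<open>Only meaningful for matrices of positive determinant; see \<open>Rep_moebius_uhp\<close>.\<close>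

definition moebius_uhp :: "int ^ 2 ^ 2 \<Rightarrow> uhp \<Rightarrow> uhp" where
  "moebius_uhp A \<tau> = Abs_uhp ((of_int (A $ 1 $ 1) * Rep_uhp \<tau> + of_int (A $ 1 $ 2)) /
                          (of_int (A $ 2 $ 1) * Rep_uhp \<tau> + of_int (A $ 2 $ 2)))"

lemma Rep_moebius_uhp:
  assumes "det A = 1"
  shows "Rep_uhp (moebius_uhp A \<tau>) =
    (of_int (A $ 1 $ 1) * Rep_uhp \<tau> + of_int (A $ 1 $ 2)) /
    (of_int (A $ 2 $ 1) * Rep_uhp \<tau> + of_int (A $ 2 $ 2))"
proof -
  define z where "z = Rep_uhp \<tau>"
  define a b c d where "a = real_of_int (A $ 1 $ 1)" and "b = real_of_int (A $ 1 $ 2)"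
    and "c = real_of_int (A $ 2 $ 1)" and "d = real_of_int (A $ 2 $ 2)"
  have z: "Im z > 0" using Rep_uhp[of \<tau>] by (simp add: z_def)
  have "A $ 1 $ 1 * A $ 2 $ 2 - A $ 1 $ 2 * A $ 2 $ 1 = 1"
    using assms by (simp add: det_2)
  hence det: "a * d - b * c = 1"
    unfolding a_def b_def c_def d_def by (metis of_int_1 of_int_diff of_int_mult)
  define w where "w = (of_real a * z + of_real b) / (of_real c * z + of_real d)"
  have "c \<noteq> 0 \<or> d \<noteq> 0" using det by auto
  hence nz: "of_real c * z + of_real d \<noteq> 0"
    using z by (auto simp: complex_eq_iff)
  hence pos: "(c * Re z + d)\<^sup>2 + (c * Im z)\<^sup>2 > 0"
    by (auto simp: complex_eq_iff sum_power2_gt_zero_iff)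
  have "a * Im z * (c * Re z + d) - (a * Re z + b) * (c * Im z) = (a * d - b * c) * Im z"
    by (simp add: algebra_simps)
  hence "Im w = Im z / ((c * Re z + d)\<^sup>2 + (c * Im z)\<^sup>2)"
    unfolding w_def using det by (simp add: Im_divide)
  hence "Im w > 0" using z pos by simp
  thus ?thesis
    by (simp add: moebius_uhp_def Abs_uhp_inverse w_def z_def a_def b_def c_def d_def)
qed

end

theory Submission
  imports Defs "HOL-Complex_Analysis.Complex_Analysis" "HOL-Probability.Probability"
begin

text \<open>
  By the Jacobi triple product, \<open>B\<^sub>k\<^sub>,\<^sub>j(\<tau>)\<close> is a quotient of two theta series
  \<open>\<Sum>\<^sub>n (-1)\<^sup>n exp(\<pi> i \<kappa> \<tau> (n + x)\<^sup>2)\<close>: the numerator has \<open>\<kappa> = 2k\<close> and \<open>x = (j-1)/(2k)\<close>, and the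
  denominator is the Dedekind eta function, written (pentagonal number theorem) with \<open>\<kappa> = 3\<close>
  and \<open>x = 1/6\<close>. Poisson summation relates such a series at \<open>\<tau>\<close> to one
  at \<open>-1/\<tau>\<close> with characters \<open>exp(2 \<pi> i m x)\<close> and Gaussian exponents \<open>(m - 1/2)\<^sup>2\<close>. The map
  \<open>\<tau> \<mapsto> \<tau>/(1 + 2n\<tau>)\<close> shifts \<open>-1/\<tau>\<close> by \<open>-2n\<close>, which multiplies the \<open>m\<close>-th dual term by a phase
  depending only on \<open>m\<close> modulo \<open>2k\<close>; a finite Fourier expansion of that phase turns the result
  back into a combination of the original series. The automorphy factor does not depend on
  \<open>\<kappa>\<close>, hence cancels against that of eta. Finally, these maps and the
  translations generate the action of \<open>\<Gamma>\<^sub>0(2)\<close>.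
\<close>

section \<open>Gaussian series over the integers\<close>

text \<open>Evenness of the lower-left entry is what makes the dual phases periodic. A shift of
  -1/\<tau> by -c multiplies the m-th dual term by exp(-pi i c (m - 1/2)^2 / (2k)). Replacing m by m
  + 2k changes this phase by exp(-pi i c (2m - 1 + 2k)), and 2m - 1 + 2k is odd, so the period 2k
  occurs exactly for even c. The finite Fourier expansion produces all shifts s/(2k) with 0 \<le> s
  < 2k, twice as many as there are generators. The reflection x -> 1 - x negates the series, so it
  folds the shifts s > k back to s < k and forces the series with s = k to vanish. For the
  denominator, a transformation law inside a larger family would not do: to divide by eta, it has to
  be reproduced up to a scalar. With \<kappa> = 3 the phase is constant on the classes 0 and 1
  modulo 3, and the terms of class 2 cancel in pairs.\<close>

lemma summable_on_gaussian_int: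
  fixes A B :: real
  assumes "A > 0"
  shows "(\<lambda>n::int. exp (- A * (of_int n)\<^sup>2 + B * \<bar>of_int n\<bar>)) summable_on UNIV"
proof -
  \<comment> \<open>\<open>C\<close> is the maximum of exp((B + 1) x - A x^2) over real x, so
    completing the square bounds each term by \<open>C\<close> exp(-|n|).\<close>
  define C where "C = exp ((B + 1)\<^sup>2 / (4 * A))"
  define g :: "int \<Rightarrow> real" where "g n = exp (- 1) ^ nat \<bar>n\<bar>" for n
  have nat: "(\<lambda>n::nat. exp (- 1 :: real) ^ n) summable_on UNIV"
    by (subst summable_on_UNIV_nonneg_real_iff) (auto intro!: summable_geometric)
  have "g summable_on range int"
    using nat by (subst summable_on_reindex) (auto simp: o_def g_def inj_on_def)
  moreover have "g summable_on range (\<lambda>n. - int n)"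
    using nat by (subst summable_on_reindex) (auto simp: o_def g_def inj_on_def)
  ultimately have "g summable_on (range int \<union> range (\<lambda>n. - int n))"
    by (rule summable_on_union)
  moreover have "range int \<union> range (\<lambda>n. - int n) = UNIV"
    by (rule UNIV_eq_I [symmetric]) (metis UnI1 UnI2 int_cases2 rangeI)
  ultimately have "g summable_on UNIV" by simp
  hence "(\<lambda>n. C * g n) summable_on UNIV"
    by (rule summable_on_cmult_right)
  moreover have "exp (- A * (of_int n)\<^sup>2 + B * \<bar>of_int n\<bar>) \<le> C * g n" for n :: int
  proof -
    define x :: real where "x = \<bar>of_int n\<bar>"
    have "0 \<le> (2 * A * x - (B + 1))\<^sup>2" by simp
    also have "\<dots> = 4 * A * (A * x\<^sup>2 - (B + 1) * x) + (B + 1)\<^sup>2"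
      by (simp add: power2_eq_square algebra_simps)
    finally have "(B + 1) * x - A * x\<^sup>2 \<le> (B + 1)\<^sup>2 / (4 * A)"
      using assms by (simp add: field_simps)
    hence "- A * (of_int n)\<^sup>2 + B * \<bar>of_int n\<bar> \<le> (B + 1)\<^sup>2 / (4 * A) + (- x)"
      by (simp add: x_def algebra_simps)
    hence "exp (- A * (of_int n)\<^sup>2 + B * \<bar>of_int n\<bar>) \<le> C * exp (- x)"
      unfolding C_def by (subst exp_add [symmetric]) simp
    also have "exp (- x) = g n"
      by (simp add: g_def x_def flip: exp_of_nat_mult)
    finally show ?thesis by simp
  qed
  ultimately show ?thesis
    by (rule summable_on_comparison_test) simp_all
qed

text \<open>All series below have this shape. Three free coefficients let one convergence argument
  cover dependence on the modulus as well as on the shift.\<close>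

definition gauss_term :: "complex \<Rightarrow> complex \<Rightarrow> complex \<Rightarrow> int \<Rightarrow> complex" where
  "gauss_term a b c n = exp (a * (of_int n)\<^sup>2 + b * of_int n + c)"

lemma norm_gauss_term_le:
  assumes "Re a \<le> - A" "\<bar>Re b\<bar> \<le> B" "Re c \<le> C"
  shows "norm (gauss_term a b c n) \<le> exp C * exp (- A * (of_int n)\<^sup>2 + B * \<bar>of_int n\<bar>)"
proof -
  have "Re a * (of_int n)\<^sup>2 \<le> - A * (of_int n)\<^sup>2"
    using assms by (intro mult_right_mono) auto
  moreover have "Re b * of_int n \<le> B * \<bar>of_int n\<bar>"
    using mult_right_mono [OF assms(2), of "\<bar>of_int n\<bar>"]
    by (simp flip: abs_mult)
  ultimately have "Re (a * (of_int n)\<^sup>2 + b * of_int n + c) \<le>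
      C + (- A * (of_int n)\<^sup>2 + B * \<bar>of_int n\<bar>)"
    using assms(3) by (simp add: power2_eq_square)
  thus ?thesis unfolding gauss_term_def norm_exp_eq_Re
    by (subst exp_add [symmetric]) simp
qed

lemma gauss_term_majorant_summable_on:
  fixes A B C :: real
  assumes "A > 0"
  shows "(\<lambda>n::int. exp C * exp (- A * (of_int n)\<^sup>2 + B * \<bar>of_int n\<bar>)) summable_on UNIV"
  using summable_on_gaussian_int [OF assms] by (rule summable_on_cmult_right)

lemma gauss_term_abs_summable_on:
  assumes "Re a < 0"
  shows "(\<lambda>n. norm (gauss_term a b c n)) summable_on UNIV"
proof (rule Infinite_Sum.abs_summable_on_comparison_test')
  show "(\<lambda>n::int. exp (Re c) * exp (- (- Re a) * (of_int n)\<^sup>2 + \<bar>Re b\<bar> * \<bar>of_int n\<bar>)) summable_on UNIV"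
    using assms by (intro gauss_term_majorant_summable_on) auto
qed (use norm_gauss_term_le [of a "- Re a" b "\<bar>Re b\<bar>" c "Re c"] in auto)

lemma gauss_term_summable_on:
  "Re a < 0 \<Longrightarrow> gauss_term a b c summable_on UNIV"
  using Infinite_Sum.abs_summable_summable gauss_term_abs_summable_on by blast

text \<open>Passes from unordered sums over the integers to sequences of symmetric partial sums, the
  form in which Fourier series and locally uniform limits of holomorphic functions are
  treated.\<close>

lemma filterlim_symmetric_int_intervals:
  "filterlim (\<lambda>N::nat. {- int N..int N}) (finite_subsets_at_top UNIV) sequentially"
  unfolding filterlim_finite_subsets_at_top
proof safe
  fix X :: "int set" assume X: "finite X"
  have "\<forall>\<^sub>F N in sequentially. nat \<bar>x\<bar> \<le> N" for x :: int
    by (rule eventually_ge_at_top)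
  hence "\<forall>\<^sub>F N in sequentially. \<forall>x\<in>X. nat \<bar>x\<bar> \<le> N"
    using X by (simp add: eventually_ball_finite)
  thus "\<forall>\<^sub>F N in sequentially. finite {- int N..int N} \<and> X \<subseteq> {- int N..int N} \<and> {- int N..int N} \<subseteq> UNIV"
    by eventually_elim force
qed

text \<open>On a compact set the continuous coefficients are bounded, and Re a stays below a
  negative constant, so a single Gaussian majorant serves for the Weierstrass M-test.\<close>

lemma uniform_limit_gauss_sum:
  assumes S: "compact S" "continuous_on S a" "continuous_on S b" "continuous_on S c"
    and neg: "\<And>w. w \<in> S \<Longrightarrow> Re (a w) < 0"
  shows "uniform_limit S (\<lambda>N w. \<Sum>n\<in>{- int N..int N}. gauss_term (a w) (b w) (c w) n)
           (\<lambda>w. \<Sum>\<^sub>\<infinity>n. gauss_term (a w) (b w) (c w) n) sequentially"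
proof (cases "S = {}")
  case False
  obtain A where A: "A > 0" "\<And>w. w \<in> S \<Longrightarrow> Re (a w) \<le> - A"
  proof -
    have "continuous_on S (\<lambda>w. Re (a w))" by (intro continuous_intros S)
    then obtain w0 where w0: "w0 \<in> S" "\<And>w. w \<in> S \<Longrightarrow> Re (a w) \<le> Re (a w0)"
      using continuous_attains_sup [OF S(1) False] by blast
    show ?thesis using that [of "- Re (a w0)"] w0 neg by force
  qed
  obtain B where B: "\<And>w. w \<in> S \<Longrightarrow> \<bar>Re (b w)\<bar> \<le> B"
  proof -
    have "continuous_on S (\<lambda>w. \<bar>Re (b w)\<bar>)" by (intro continuous_intros S)
    then show ?thesis
      using continuous_attains_sup [OF S(1) False] that by metis
  qed
  obtain C where C: "\<And>w. w \<in> S \<Longrightarrow> Re (c w) \<le> C"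
  proof -
    have "continuous_on S (\<lambda>w. Re (c w))" by (intro continuous_intros S)
    then show ?thesis
      using continuous_attains_sup [OF S(1) False] that by metis
  qed
  have "uniform_limit S (\<lambda>X w. \<Sum>n\<in>X. gauss_term (a w) (b w) (c w) n)
           (\<lambda>w. \<Sum>\<^sub>\<infinity>n. gauss_term (a w) (b w) (c w) n) (finite_subsets_at_top UNIV)"
    by (rule Weierstrass_m_test_general
          [OF norm_gauss_term_le gauss_term_majorant_summable_on [OF A(1), where B=B and C=C]])
       (use A B C in auto)
  thus ?thesis
    by (rule filterlim_compose [OF _ filterlim_symmetric_int_intervals])
qed (simp add: uniform_limit_iff)

lemma holomorphic_on_gauss_sum:
  assumes S: "open S" "a holomorphic_on S" "b holomorphic_on S" "c holomorphic_on S"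
    and neg: "\<And>w. w \<in> S \<Longrightarrow> Re (a w) < 0"
  shows "(\<lambda>w. \<Sum>\<^sub>\<infinity>n. gauss_term (a w) (b w) (c w) n) holomorphic_on S"
proof (rule holomorphic_uniform_sequence [OF S(1)])
  show "(\<lambda>w. \<Sum>n\<in>{- int N..int N}. gauss_term (a w) (b w) (c w) n) holomorphic_on S" for N
    unfolding gauss_term_def by (intro holomorphic_intros S)
next
  fix w assume "w \<in> S"
  then obtain d where d: "d > 0" "cball w d \<subseteq> S"
    using S(1) open_contains_cball by blast
  have "uniform_limit (cball w d)
     (\<lambda>N w. \<Sum>n\<in>{- int N..int N}. gauss_term (a w) (b w) (c w) n)
           (\<lambda>w. \<Sum>\<^sub>\<infinity>n. gauss_term (a w) (b w) (c w) n) sequentially"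
    using d neg S by (intro uniform_limit_gauss_sum)
      (auto intro!: holomorphic_on_imp_continuous_on intro: holomorphic_on_subset)
  with d show "\<exists>d>0. cball w d \<subseteq> S \<and> uniform_limit (cball w d)
     (\<lambda>N w. \<Sum>n\<in>{- int N..int N}. gauss_term (a w) (b w) (c w) n)
           (\<lambda>w. \<Sum>\<^sub>\<infinity>n. gauss_term (a w) (b w) (c w) n) sequentially"
    by blast
qed

text \<open>Tannery's theorem: the majorant makes the finite partial sums converge uniformly in N,
  which allows the two limits to be exchanged.\<close>

lemma infsum_dominated_convergence:
  fixes f :: "'a \<Rightarrow> 'b \<Rightarrow> 'c :: banach"
  assumes lim: "\<And>n. (f n \<longlongrightarrow> g n) F"
    and bound: "\<And>n N. norm (f n N) \<le> M n" and M: "M summable_on UNIV"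
    and "F \<noteq> bot"
  shows "((\<lambda>N. \<Sum>\<^sub>\<infinity>n. f n N) \<longlongrightarrow> (\<Sum>\<^sub>\<infinity>n. g n)) F"
proof (rule swap_uniform_limit')
  show "\<forall>\<^sub>F X in finite_subsets_at_top UNIV. ((\<lambda>N. \<Sum>n\<in>X. f n N) \<longlongrightarrow> (\<Sum>n\<in>X. g n)) F"
    by (intro always_eventually allI tendsto_sum lim)
  have "norm (g n) \<le> M n" for n
    using lim bound \<open>F \<noteq> bot\<close> by (intro Lim_norm_ubound [of F "f n"]) auto
  hence "(\<lambda>n. norm (g n)) summable_on UNIV"
    by (rule Infinite_Sum.abs_summable_on_comparison_test' [OF M])
  hence "g summable_on UNIV"
    by (rule Infinite_Sum.abs_summable_summable)
  thus "((\<lambda>X. \<Sum>n\<in>X. g n) \<longlongrightarrow> (\<Sum>\<^sub>\<infinity>n. g n)) (finite_subsets_at_top UNIV)"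
    using has_sum_def has_sum_infsum by blast
  show "uniform_limit UNIV (\<lambda>X N. \<Sum>n\<in>X. f n N) (\<lambda>N. \<Sum>\<^sub>\<infinity>n. f n N) (finite_subsets_at_top UNIV)"
    by (rule Weierstrass_m_test_general [OF bound M])
qed auto

section \<open>Poisson summation for Gaussians\<close>

text \<open>This is the characteristic function of the standard normal distribution after a linear
  change of variable.\<close>

lemma has_bochner_integral_gaussian_fourier:
  fixes t s :: real
  assumes t: "t > 0"
  shows "has_bochner_integral lborel (\<lambda>u. exp (of_real (- pi * t * u\<^sup>2) - 2 * of_real pi * \<i> * of_real s * of_real u))
           (of_real (exp (- pi * s\<^sup>2 / t) / sqrt t) :: complex)"
proof -
  \<comment> \<open>The scale is chosen so that (c u)^2 / 2 = pi t u^2, and the frequency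
    \<open>\<xi>\<close> so that \<open>\<xi> * c\<close> = -2 pi s. The factor sqrt(2 pi) used
    below removes the normalization of the density.\<close>
  define c where "c = sqrt (2 * pi * t)"
  define \<xi> where "\<xi> = - 2 * pi * s / c"
  have c: "c > 0" "c\<^sup>2 = 2 * pi * t" using t by (auto simp: c_def)
  let ?g = "\<lambda>x. std_normal_density x *\<^sub>R iexp (\<xi> * x)"
  have "integrable lborel (\<lambda>x. std_normal_density x)" by simp
  hence int: "integrable lborel ?g"
    by (rule Bochner_Integration.integrable_bound) (auto simp: norm_mult)
  have "complex_of_real (exp (- \<xi>\<^sup>2 / 2)) = (LINT x|lborel. ?g x)"
    using fun_cong [OF char_std_normal_distribution, of \<xi>]
    by (simp add: char_def integral_density)
  hence "has_bochner_integral lborel ?g (complex_of_real (exp (- \<xi>\<^sup>2 / 2)))"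
    using int by (simp add: has_bochner_integral_iff)
  hence "has_bochner_integral lborel (\<lambda>x. ?g (0 + c * x)) (complex_of_real (exp (- \<xi>\<^sup>2 / 2)) /\<^sub>R \<bar>c\<bar>)"
    using c by (subst (asm) lborel_has_bochner_integral_real_affine_iff [where c = c and t = 0]) auto
  hence "has_bochner_integral lborel (\<lambda>x. of_real (sqrt (2 * pi)) * ?g (0 + c * x))
     (of_real (sqrt (2 * pi)) * (complex_of_real (exp (- \<xi>\<^sup>2 / 2)) /\<^sub>R \<bar>c\<bar>))"
    by (intro has_bochner_integral_mult_right) auto
  moreover have "of_real (sqrt (2 * pi)) * ?g (0 + c * u) =
      exp (of_real (- pi * t * u\<^sup>2) - 2 * of_real pi * \<i> * of_real s * of_real u)" for u
  proof -
    have "exp (- (c * u)\<^sup>2 / 2) = exp (- pi * t * u\<^sup>2)"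
      using c by (simp add: power_mult_distrib)
    hence "sqrt (2 * pi) * std_normal_density (c * u) = exp (- pi * t * u\<^sup>2)"
      by (simp add: std_normal_density_def)
    hence "of_real (sqrt (2 * pi)) * ?g (0 + c * u) = of_real (exp (- pi * t * u\<^sup>2)) * iexp (\<xi> * (c * u))"
      by (simp add: scaleR_conv_of_real flip: of_real_mult)
    also have "\<xi> * (c * u) = - 2 * pi * s * u"
      using c by (simp add: \<xi>_def)
    finally show ?thesis
      by (simp add: exp_diff exp_minus exp_of_real [symmetric] field_simps)
  qed
  moreover have "of_real (sqrt (2 * pi)) * (complex_of_real (exp (- \<xi>\<^sup>2 / 2)) /\<^sub>R \<bar>c\<bar>) =
      of_real (exp (- pi * s\<^sup>2 / t) / sqrt t)"
  proof -
    have "\<xi>\<^sup>2 / 2 = pi * s\<^sup>2 / t"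
      using c t by (simp add: \<xi>_def power_divide power_mult_distrib) (simp add: power2_eq_square)
    hence "exp (- \<xi>\<^sup>2 / 2) = exp (- pi * s\<^sup>2 / t)" by simp
    moreover have "sqrt (2 * pi) * (inverse \<bar>c\<bar>) = 1 / sqrt t"
      using t by (simp add: c_def real_sqrt_mult field_simps)
    ultimately have "sqrt (2 * pi) * (inverse \<bar>c\<bar> * exp (- \<xi>\<^sup>2 / 2)) = exp (- pi * s\<^sup>2 / t) / sqrt t"
      by (metis mult.assoc mult.commute times_divide_eq_right mult.right_neutral)
    thus ?thesis
      by (simp only: scaleR_conv_of_real flip: of_real_mult)
  qed
  ultimately show ?thesis by simp
qed

section \<open>Pointwise convergence of Fourier series and periodization\<close>

lemma exp_2pi_int [simp]: "exp (2 * of_real pi * \<i> * of_int n :: complex) = 1"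
  using exp_integer_2pi [OF Ints_of_int, of n] by (simp add: mult_ac)

lemma integral_exp_2pi_int:
  fixes m :: int
  shows "integral {-1/2..1/2} (\<lambda>x::real. exp (- 2 * of_real pi * \<i> * of_int m * of_real x)) =
           (if m = 0 then 1 else 0 :: complex)"
proof (cases "m = 0")
  case False
  define k :: complex where "k = - 2 * of_real pi * \<i> * of_int m"
  have k: "k \<noteq> 0" using False by (simp add: k_def)
  have "((\<lambda>x::real. exp (k * of_real x)) has_integral
          (exp (k * of_real (1/2)) / k - exp (k * of_real (-1/2)) / k)) {-1/2..1/2}"
  proof (rule fundamental_theorem_of_calculus)
    fix x :: real
    have "((\<lambda>z. exp (k * z) / k) has_field_derivative exp (k * of_real x)) (at (of_real x))"
      using k by (auto intro!: derivative_eq_intros)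
    thus "((\<lambda>x. exp (k * of_real x) / k) has_vector_derivative exp (k * of_real x)) (at x within {-1/2..1/2})"
      by (rule has_vector_derivative_real_field)
  qed auto
  moreover have "exp (k * of_real (1/2)) = exp (k * of_real (-1/2))"
  proof -
    have "exp (k * of_real (1/2)) = exp (k * of_real (-1/2) + 2 * of_real pi * \<i> * of_int (- m))"
      by (rule arg_cong [of _ _ exp]) (simp add: k_def field_simps)
    also have "\<dots> = exp (k * of_real (-1/2))"
      by (simp only: exp_add exp_2pi_int mult_1_right)
    finally show ?thesis .
  qed
  ultimately show ?thesis using False
    by (simp add: k_def integral_unique)
qed auto

text \<open>One integration by parts gains the factor 1/|m|. As g need not be periodic, the boundary
  terms remain, but they are of the same order.\<close>

lemma fourier_coefficient_bound:
  fixes g :: "complex \<Rightarrow> complex"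
  assumes g: "g holomorphic_on ball 0 1"
  obtains K where "\<And>m::int. m \<noteq> 0 \<Longrightarrow>
    norm (integral {-1/2..1/2} (\<lambda>x::real. g (of_real x) * exp (- 2 * of_real pi * \<i> * of_int m * of_real x))) \<le> K / \<bar>of_int m\<bar>"
proof -
  have sub: "complex_of_real ` {-1/2..1/2} \<subseteq> ball 0 1" by auto
  have contg: "continuous_on {-1/2..1/2} (\<lambda>x::real. g (of_real x))"
    by (rule continuous_on_compose2 [OF holomorphic_on_imp_continuous_on [OF g] _ sub])
       (intro continuous_intros)
  have contg': "continuous_on {-1/2..1/2} (\<lambda>x::real. deriv g (of_real x))"
    by (rule continuous_on_compose2 [OF holomorphic_on_imp_continuous_on [OF holomorphic_deriv [OF g]] _ sub])
       (auto intro!: continuous_intros)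
  obtain G where G: "\<And>x. x \<in> {-1/2..1/2} \<Longrightarrow> norm (g (of_real x)) \<le> G"
    using compact_continuous_image [OF contg] by (metis (no_types, lifting) bounded_iff compact_Icc compact_imp_bounded imageI)
  obtain G' where G': "\<And>x. x \<in> {-1/2..1/2} \<Longrightarrow> norm (deriv g (of_real x)) \<le> G'"
    using compact_continuous_image [OF contg'] by (metis (no_types, lifting) bounded_iff compact_Icc compact_imp_bounded imageI)
  show ?thesis
  proof (rule that)
    fix m :: int assume m: "m \<noteq> 0"
    define k :: complex where "k = - 2 * of_real pi * \<i> * of_int m"
    define e where "e x = exp (k * of_real x)" for x :: real
    have k: "k \<noteq> 0" "norm k = 2 * pi * \<bar>of_int m\<bar>" using m by (auto simp: k_def norm_mult)
    have e: "norm (e x) = 1" for x by (simp add: e_def k_def)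
    have conte: "continuous_on {-1/2..1/2} e" unfolding e_def by (intro continuous_intros)
    have "((\<lambda>x. g (of_real x) * e x + deriv g (of_real x) * e x / k) has_integral
        (g (of_real (1/2)) * e (1/2) / k - g (of_real (-1/2)) * e (-1/2) / k)) {-1/2..1/2}"
    proof (rule fundamental_theorem_of_calculus)
      fix x :: real assume x: "x \<in> {-1/2..1/2}"
      have "(g has_field_derivative deriv g (of_real x)) (at (of_real x))"
        using x g by (intro holomorphic_derivI [of _ "ball 0 1"]) auto
      hence "((\<lambda>z. g z * exp (k * z) / k) has_field_derivative
           g (of_real x) * e x + deriv g (of_real x) * e x / k) (at (of_real x))"
        using k by (auto intro!: derivative_eq_intros simp: e_def field_simps)
      hence "((\<lambda>x. g (of_real x) * exp (k * of_real x) / k) has_vector_derivative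
           g (of_real x) * e x + deriv g (of_real x) * e x / k) (at x within {-1/2..1/2})"
        by (rule has_vector_derivative_real_field)
      thus "((\<lambda>x. g (of_real x) * e x / k) has_vector_derivative
           g (of_real x) * e x + deriv g (of_real x) * e x / k) (at x within {-1/2..1/2})"
        by (simp add: e_def)
    qed auto
    moreover have I1: "(\<lambda>x. deriv g (of_real x) * e x / k) integrable_on {-1/2..1/2}"
      by (intro integrable_continuous_interval continuous_intros contg' conte) (use k in auto)
    ultimately have "((\<lambda>x. g (of_real x) * e x) has_integral
        (g (of_real (1/2)) * e (1/2) / k - g (of_real (-1/2)) * e (-1/2) / k
        - integral {-1/2..1/2} (\<lambda>x. deriv g (of_real x) * e x / k))) {-1/2..1/2}"
      using has_integral_diff [OF _ integrable_integral [OF I1]] by fastforce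
    hence eq: "integral {-1/2..1/2} (\<lambda>x. g (of_real x) * e x) =
        g (of_real (1/2)) * e (1/2) / k - g (of_real (-1/2)) * e (-1/2) / k
        - integral {-1/2..1/2} (\<lambda>x. deriv g (of_real x) * e x / k)"
      by (rule integral_unique)
    have "norm (integral {-1/2..1/2} (\<lambda>x. deriv g (of_real x) * e x / k)) \<le> G' / norm k * (1/2 - (-1/2))"
    proof (rule integral_bound)
      show "continuous_on {-1/2..1/2} (\<lambda>x. deriv g (of_real x) * e x / k)"
        by (intro continuous_intros contg' conte) (use k in auto)
      show "norm (deriv g (of_real x) * e x / k) \<le> G' / norm k" if "x \<in> {-1/2..1/2}" for x
        using G' [OF that] by (auto simp: norm_mult norm_divide e intro!: divide_right_mono)
    qed auto
    moreover have "norm (g (of_real (1/2)) * e (1/2) / k) \<le> G / norm k"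
      using G [of "1/2"] by (auto simp: norm_mult norm_divide e intro!: divide_right_mono)
    moreover have "norm (g (of_real (-1/2)) * e (-1/2) / k) \<le> G / norm k"
      using G [of "-1/2"] by (auto simp: norm_mult norm_divide e intro!: divide_right_mono)
    ultimately have "norm (integral {-1/2..1/2} (\<lambda>x. g (of_real x) * e x)) \<le> G / norm k + G / norm k + G' / norm k"
      unfolding eq by (intro order_trans [OF norm_triangle_ineq4] add_mono) auto
    also have "\<dots> = ((2 * G + G') / (2 * pi)) / \<bar>of_int m\<bar>"
      using m by (simp add: k divide_simps)
    finally show "norm (integral {-1/2..1/2} (\<lambda>x::real. g (of_real x) * exp (- 2 * of_real pi * \<i> * of_int m * of_real x)))
       \<le> ((2 * G + G') / (2 * pi)) / \<bar>of_int m\<bar>"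
      by (simp add: e_def k_def)
  qed
qed

lemma sum_int_telescope:
  fixes d :: "int \<Rightarrow> 'a :: ab_group_add"
  shows "(\<Sum>m\<in>{- int N..int N}. d (m - 1) - d m) = d (- int N - 1) - d (int N)"
proof (induction N)
  case (Suc N)
  have "{- int (Suc N)..int (Suc N)} = insert (- int N - 1) (insert (int N + 1) {- int N..int N})"
    by auto
  thus ?case using Suc by (simp add: add.commute)
qed simp

text \<open>Chernoff's proof of pointwise convergence: with \<open>F(z) = F(0) + g(z) (exp(2 \<pi> i z) - 1)\<close> the
  Fourier coefficients of \<open>F - F(0)\<close> are differences of consecutive coefficients of \<open>g\<close>, so the
  partial sums telescope.\<close>

lemma fourier_series_at_0:
  fixes F :: "complex \<Rightarrow> complex"
  assumes F: "F holomorphic_on ball 0 1"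
  shows "(\<lambda>N. \<Sum>m\<in>{- int N..int N}. integral {-1/2..1/2}
           (\<lambda>x::real. F (of_real x) * exp (- 2 * of_real pi * \<i> * of_int m * of_real x)))
         \<longlonglongrightarrow> F 0"
proof -
  define E where "E z = (if z = 0 then 2 * of_real pi * \<i> else (exp (2 * of_real pi * \<i> * z) - 1) / z)" for z :: complex
  define A where "A z = (if z = 0 then deriv F 0 else (F z - F 0) / z)" for z
  define g where "g z = A z / E z" for z
  have "E holomorphic_on ball 0 1"
  proof (rule pole_theorem_open_0 [where a = 0])
    show "E 0 = deriv (\<lambda>z. exp (2 * of_real pi * \<i> * z) - 1) 0"
      unfolding E_def by (auto intro!: DERIV_imp_deriv [symmetric] derivative_eq_intros)
  qed (auto simp: E_def intro!: holomorphic_intros)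
  moreover have "A holomorphic_on ball 0 1"
  proof (rule pole_theorem_open_0 [where a = 0])
    have "(F has_field_derivative deriv F 0) (at 0)"
      using F by (intro holomorphic_derivI [of _ "ball 0 1"]) auto
    hence "((\<lambda>z. F z - F 0) has_field_derivative deriv F 0) (at 0)"
      by (auto intro!: derivative_eq_intros)
    thus "A 0 = deriv (\<lambda>z. F z - F 0) 0"
      unfolding A_def by (auto intro!: DERIV_imp_deriv [symmetric])
  qed (auto simp: A_def intro!: holomorphic_intros F)
  \<comment> \<open>The zeros of exp(2 pi i z) - 1 are the integers, and only 0 lies in the open
    unit disc. There the quotient \<open>E\<close> has the value 2 pi i, so \<open>g\<close> is
    holomorphic on the whole disc.\<close>
  moreover have E0: "E z \<noteq> 0" if "z \<in> ball 0 1" for z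
  proof (cases "z = 0")
    case False
    show ?thesis
    proof
      assume "E z = 0"
      hence "exp (2 * of_real pi * \<i> * z) = 1" using False by (simp add: E_def)
      then obtain n :: int where n: "Im (2 * of_real pi * \<i> * z) = of_int (2 * n) * pi"
          "Re (2 * of_real pi * \<i> * z) = 0"
        unfolding exp_eq_1 by blast
      hence z: "z = of_int n"
        by (auto simp: complex_eq_iff)
      hence "n \<noteq> 0" "\<bar>real_of_int n\<bar> < 1"
        using that False by auto
      thus False by linarith
    qed
  qed (simp add: E_def)
  ultimately have g: "g holomorphic_on ball 0 1"
    unfolding g_def by (intro holomorphic_intros)
  have F_eq: "F z = F 0 + g z * (exp (2 * of_real pi * \<i> * z) - 1)" if "z \<in> ball 0 1" for z
    using E0 [OF that] by (auto simp: g_def A_def E_def split: if_splits)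
  define e where "e m x = exp (- 2 * of_real pi * \<i> * of_int m * of_real x)" for m :: int and x :: real
  define d where "d m = integral {-1/2..1/2} (\<lambda>x::real. g (of_real x) * e m x)" for m
  have conte: "continuous_on {-1/2..1/2} (e m)" for m unfolding e_def by (intro continuous_intros)
  have contg: "continuous_on {-1/2..1/2} (\<lambda>x::real. g (of_real x))"
    by (rule continuous_on_compose2 [OF holomorphic_on_imp_continuous_on [OF g]])
       (auto intro!: continuous_intros)
  have coeff: "integral {-1/2..1/2} (\<lambda>x::real. F (of_real x) * e m x) =
      (if m = 0 then F 0 else 0) + (d (m - 1) - d m)" for m
  proof -
    have "integral {-1/2..1/2} (\<lambda>x::real. F (of_real x) * e m x) =
        integral {-1/2..1/2} (\<lambda>x::real. F 0 * e m x + (g (of_real x) * e (m - 1) x - g (of_real x) * e m x))"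
    proof (rule Henstock_Kurzweil_Integration.integral_cong)
      fix x :: real assume "x \<in> {-1/2..1/2}"
      hence "F (of_real x) = F 0 + g (of_real x) * (exp (2 * of_real pi * \<i> * of_real x) - 1)"
        by (intro F_eq) auto
      moreover have "exp (2 * of_real pi * \<i> * of_real x) * e m x = e (m - 1) x"
        unfolding e_def by (subst exp_add [symmetric]) (simp add: algebra_simps)
      ultimately show "F (of_real x) * e m x = F 0 * e m x + (g (of_real x) * e (m - 1) x - g (of_real x) * e m x)"
        by (simp add: ring_distribs mult.assoc)
    qed
    also have "\<dots> = integral {-1/2..1/2} (\<lambda>x::real. F 0 * e m x) + (d (m - 1) - d m)"
    proof -
      have i: "(\<lambda>x. F 0 * e m x) integrable_on {-1/2..1/2}"
        "(\<lambda>x. g (of_real x) * e m x) integrable_on {-1/2..1/2}" for m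
        by (intro integrable_continuous_interval continuous_intros contg conte)+
      show ?thesis unfolding d_def
        by (intro integral_unique has_integral_add has_integral_diff integrable_integral i)
    qed
    also have "integral {-1/2..1/2} (\<lambda>x::real. F 0 * e m x) = (if m = 0 then F 0 else 0)"
      using integral_exp_2pi_int [of m] by (simp add: e_def)
    finally show ?thesis .
  qed
  have "(\<Sum>m\<in>{- int N..int N}. integral {-1/2..1/2} (\<lambda>x::real. F (of_real x) * e m x)) =
      F 0 + (d (- int N - 1) - d (int N))" for N
    unfolding coeff sum.distrib sum_int_telescope by simp
  moreover have "(\<lambda>N. d (- int N - 1)) \<longlonglongrightarrow> 0" "(\<lambda>N. d (int N)) \<longlonglongrightarrow> 0"
  proof -
    obtain K where K: "\<And>m. m \<noteq> 0 \<Longrightarrow> norm (d m) \<le> K / \<bar>of_int m\<bar>"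
      using fourier_coefficient_bound [OF g] unfolding d_def e_def by metis
    have "(\<lambda>N. K / \<bar>of_int (- int N - 1)\<bar>) \<longlonglongrightarrow> 0" "(\<lambda>N. K / \<bar>of_int (int N)\<bar>) \<longlonglongrightarrow> 0"
      by real_asymp+
    moreover have "\<forall>\<^sub>F N in sequentially. norm (d (int N)) \<le> K / \<bar>of_int (int N)\<bar>"
      using eventually_gt_at_top [of 0] by eventually_elim (rule K, simp)
    moreover have "\<forall>\<^sub>F N in sequentially. norm (d (- int N - 1)) \<le> K / \<bar>of_int (- int N - 1)\<bar>"
      by (intro always_eventually allI K) auto
    ultimately show "(\<lambda>N. d (- int N - 1)) \<longlonglongrightarrow> 0" "(\<lambda>N. d (int N)) \<longlonglongrightarrow> 0"
      by (auto intro: Lim_null_comparison)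
  qed
  hence "(\<lambda>N. F 0 + (d (- int N - 1) - d (int N))) \<longlonglongrightarrow> F 0 + (0 - 0)"
    by (intro tendsto_intros)
  ultimately show ?thesis by (simp add: e_def)
qed

text \<open>Unfolding: the translates of [-1/2, 1/2] by |n| \<le> N tile [-N - 1/2, N + 1/2], so the
  integral of the N-th partial sum is the integral of f over that interval. Uniform convergence
  handles the limit on the left, dominated convergence the limit to the whole line.\<close>

lemma integral_periodization:
  fixes f :: "real \<Rightarrow> complex"
  assumes f: "continuous_on UNIV f" "has_bochner_integral lborel f I"
    and lim: "uniform_limit {-1/2..1/2} (\<lambda>N x. \<Sum>n\<in>{- int N..int N}. f (x + of_int n)) F sequentially"
  shows "integral {-1/2..1/2} F = I"
proof -
  have cont: "continuous_on S f" for S using f(1) continuous_on_subset by blast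
  have shift: "continuous_on S (\<lambda>x. f (x + c))" for S c
    by (rule continuous_on_compose2 [OF f(1)]) (auto intro!: continuous_intros)
  have intf: "f integrable_on {a..b}" for a b
    by (intro integrable_continuous_interval cont)
  obtain J L where J: "\<And>N. ((\<lambda>x. \<Sum>n\<in>{- int N..int N}. f (x + of_int n)) has_integral J N) {-1/2..1/2}"
      "(F has_integral L) {-1/2..1/2}" "J \<longlonglongrightarrow> L"
  proof (rule uniform_limit_integral [OF lim])
    show "continuous_on {-1/2..1/2} (\<lambda>x. \<Sum>n\<in>{- int N..int N}. f (x + of_int n))" for N
      by (intro continuous_on_sum shift)
  qed auto
  have period: "integral {-1/2..1/2} (\<lambda>x. f (x + c)) = integral {c - 1/2..c + 1/2} f" for c
    using integral_shift_real_ivl [of "c - 1/2" c "c + 1/2" f] by simp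
  have J_eq: "J N = integral {- real N - 1/2..real N + 1/2} f" for N
  proof -
    have "J N = (\<Sum>n\<in>{- int N..int N}. integral {-1/2..1/2} (\<lambda>x. f (x + of_int n)))"
      using integral_unique [OF J(1) [of N]]
      by (subst (asm) Henstock_Kurzweil_Integration.integral_sum)
         (auto intro!: integrable_continuous_interval shift)
    also have "\<dots> = (\<Sum>n\<in>{- int N..int N}. integral {of_int n - 1/2..of_int n + 1/2} f)"
      by (simp only: period)
    also have "\<dots> = integral {- real N - 1/2..real N + 1/2} f"
    proof (induction N)
      case (Suc N)
      have "{- int (Suc N)..int (Suc N)} = insert (- int N - 1) (insert (int N + 1) {- int N..int N})"
        by auto
      hence "(\<Sum>n\<in>{- int (Suc N)..int (Suc N)}. integral {of_int n - 1/2..of_int n + 1/2} f) =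
          integral {- real N - 3/2..- real N - 1/2} f +
          (integral {real N + 1/2..real N + 3/2} f + integral {- real N - 1/2..real N + 1/2} f)"
        using Suc by (simp add: algebra_simps)
      also have "\<dots> = integral {- real N - 3/2..- real N - 1/2} f + integral {- real N - 1/2..real N + 3/2} f"
        using Henstock_Kurzweil_Integration.integral_combine [of "- real N - 1/2" "real N + 1/2" "real N + 3/2" f] intf
        by (simp add: algebra_simps)
      also have "\<dots> = integral {- real N - 3/2..real N + 3/2} f"
        by (rule Henstock_Kurzweil_Integration.integral_combine) (use intf in auto)
      finally show ?case by (simp add: algebra_simps)
    qed simp
    finally show ?thesis .
  qed
  have int: "integrable lborel f" "integral\<^sup>L lborel f = I"
    using f(2) by (auto simp: has_bochner_integral_iff)
  have "(\<lambda>N. LINT x|lborel. indicator {- real N - 1/2..real N + 1/2} x *\<^sub>R f x) \<longlonglongrightarrow> (LINT x|lborel. f x)"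
  proof (rule integral_dominated_convergence [where w = "\<lambda>x. norm (f x)"])
    show "AE x in lborel. (\<lambda>N. indicator {- real N - 1/2..real N + 1/2} x *\<^sub>R f x) \<longlonglongrightarrow> f x"
    proof (intro AE_I2 tendsto_eventually)
      fix x :: real
      have "\<forall>\<^sub>F N in sequentially. nat \<lceil>\<bar>x\<bar>\<rceil> \<le> N" by (rule eventually_ge_at_top)
      thus "\<forall>\<^sub>F N in sequentially. indicator {- real N - 1/2..real N + 1/2} x *\<^sub>R f x = f x"
        by eventually_elim (simp add: indicator_def; linarith)
    qed
  qed (use int in \<open>auto simp: indicator_def\<close>)
  moreover have "(LINT x|lborel. indicator {a..b} x *\<^sub>R f x) = integral {a..b} f" for a b
  proof -
    have "set_integrable lborel {a..b} f"
      using int(1) unfolding set_integrable_def by (intro integrable_mult_indicator) auto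
    thus ?thesis
      using set_borel_integral_eq_integral(2) [of "{a..b}" f] by (simp add: set_lebesgue_integral_def)
  qed
  ultimately have "J \<longlonglongrightarrow> I" using int(2) by (simp add: J_eq [abs_def])
  hence "L = I" using J(3) LIMSEQ_unique by blast
  thus ?thesis using J(2) integral_unique by blast
qed

section \<open>Theta series and their inversion\<close>

text \<open>A theta function with characteristics. The character is exp(2 pi i n y) instead of the
  classical exp(2 pi i (n + x) y), which accounts for the factor exp(-2 pi i x y) in the inversion
  formula. The value y = 1/2 gives the sign (-1)^n.\<close>

definition theta :: "real \<Rightarrow> real \<Rightarrow> complex \<Rightarrow> complex" where
  "theta x y t = (\<Sum>\<^sub>\<infinity>n::int. exp (of_real pi * \<i> * t * (of_int n + of_real x)\<^sup>2 +
     2 * of_real pi * \<i> * of_int n * of_real y))"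

lemma theta_term_eq:
  "exp (of_real pi * \<i> * t * (of_int n + of_real x)\<^sup>2 + 2 * of_real pi * \<i> * of_int n * of_real y) =
   gauss_term (of_real pi * \<i> * t) (2 * of_real pi * \<i> * (t * of_real x + of_real y))
     (of_real pi * \<i> * t * (of_real x)\<^sup>2) n"
  unfolding gauss_term_def
  by (rule arg_cong [of _ _ exp]) (simp add: power2_eq_square algebra_simps)

lemma theta_conv_gauss_sum:
  "theta x y t = (\<Sum>\<^sub>\<infinity>n. gauss_term (of_real pi * \<i> * t) (2 * of_real pi * \<i> * (t * of_real x + of_real y))
     (of_real pi * \<i> * t * (of_real x)\<^sup>2) n)"
  unfolding theta_def theta_term_eq ..

lemma abs_summable_on_theta:
  assumes "Im t > 0"
  shows "(\<lambda>n::int. norm (exp (of_real pi * \<i> * t * (of_int n + of_real x)\<^sup>2 +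
     2 * of_real pi * \<i> * of_int n * of_real y))) summable_on UNIV"
  unfolding theta_term_eq using assms by (intro gauss_term_abs_summable_on) auto

lemma summable_on_theta:
  assumes "Im t > 0"
  shows "(\<lambda>n::int. exp (of_real pi * \<i> * t * (of_int n + of_real x)\<^sup>2 +
     2 * of_real pi * \<i> * of_int n * of_real y)) summable_on UNIV"
  unfolding theta_term_eq using assms by (intro gauss_term_summable_on) auto

lemma has_sum_theta:
  assumes "Im t > 0"
  shows "((\<lambda>n::int. exp (of_real pi * \<i> * t * (of_int n + of_real x)\<^sup>2 +
     2 * of_real pi * \<i> * of_int n * of_real y)) has_sum theta x y t) UNIV"
  unfolding theta_def using summable_on_theta [OF assms] by (rule has_sum_infsum)

lemma holomorphic_on_theta [holomorphic_intros]:
  assumes "open S" "f holomorphic_on S" "\<And>w. w \<in> S \<Longrightarrow> Im (f w) > 0"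
  shows "(\<lambda>w. theta x y (f w)) holomorphic_on S"
  unfolding theta_conv_gauss_sum
  by (rule holomorphic_on_gauss_sum) (use assms in \<open>auto intro!: holomorphic_intros\<close>)

text \<open>On the imaginary axis the Gaussian is real up to a character, so its Fourier transform
  is known. The sum over translates is made into a holomorphic function \<open>F\<close> of the
  translation parameter, and the series for \<open>F\<close> at 0 is the dual theta series.\<close>

lemma poisson_summation_gaussian:
  fixes t x y :: real
  assumes t: "t > 0"
  shows "theta x y (\<i> * of_real t) =
         exp (- 2 * of_real pi * \<i> * of_real (x * y)) / of_real (sqrt t) * theta (- y) x (\<i> / of_real t)"
proof -
  define a where "a = - complex_of_real (pi * t)"
  define b where "b z = - 2 * of_real (pi * t) * (z + of_real x) + 2 * of_real pi * \<i> * of_real y" for z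
  \<comment> \<open>The index m carries the m-th Fourier character. Since exp(-2 pi i m u) has
    period 1 in u, it may be moved inside the sum over translates: \<open>f m\<close> is the product
    of the Gaussian and this character.\<close>
  define c where "c m z = - of_real (pi * t) * (z + of_real x)\<^sup>2 + 2 * of_real pi * \<i> * z * of_real y
     - 2 * of_real pi * \<i> * of_int m * z" for m :: int and z
  define F where "F z = (\<Sum>\<^sub>\<infinity>n. gauss_term a (b z) (c 0 z) n)" for z
  define f where "f m u = exp (- of_real (pi * t) * (of_real u + of_real x)\<^sup>2 +
     2 * of_real pi * \<i> * of_real u * of_real y - 2 * of_real pi * \<i> * of_int m * of_real u)" for m :: int and u :: real
  have a: "Re a < 0" using t by (simp add: a_def)
  have gt: "gauss_term a (b (of_real u)) (c m (of_real u)) n = f m (u + of_int n)" for u m n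
  proof -
    have "f m (u + of_int n) = gauss_term a (b (of_real u)) (c m (of_real u)) n * exp (2 * of_real pi * \<i> * of_int (- m * n))"
      unfolding f_def gauss_term_def a_def b_def c_def
      by (subst exp_add [symmetric], rule arg_cong [of _ _ exp]) (simp add: power2_eq_square algebra_simps)
    thus ?thesis by (simp only: exp_2pi_int mult_1_right)
  qed
  have F_eq: "F (of_real u) * exp (- 2 * of_real pi * \<i> * of_int m * of_real u) =
      (\<Sum>\<^sub>\<infinity>n. gauss_term a (b (of_real u)) (c m (of_real u)) n)" for u m
  proof -
    have "F (of_real u) * exp (- 2 * of_real pi * \<i> * of_int m * of_real u) =
        (\<Sum>\<^sub>\<infinity>n. gauss_term a (b (of_real u)) (c 0 (of_real u)) n * exp (- 2 * of_real pi * \<i> * of_int m * of_real u))"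
      unfolding F_def by (rule infsum_cmult_left [symmetric]) (intro gauss_term_summable_on a)
    also have "\<dots> = (\<Sum>\<^sub>\<infinity>n. gauss_term a (b (of_real u)) (c m (of_real u)) n)"
      by (intro infsum_cong) (simp add: gauss_term_def c_def algebra_simps flip: exp_add)
    finally show ?thesis .
  qed
  have "F holomorphic_on ball 0 1"
    unfolding F_def
    by (rule holomorphic_on_gauss_sum) (use a in \<open>auto simp: b_def c_def intro!: holomorphic_intros\<close>)
  hence "(\<lambda>N. \<Sum>m\<in>{- int N..int N}. integral {-1/2..1/2}
           (\<lambda>u::real. F (of_real u) * exp (- 2 * of_real pi * \<i> * of_int m * of_real u))) \<longlonglongrightarrow> F 0"
    by (rule fourier_series_at_0)
  moreover have "integral {-1/2..1/2} (\<lambda>u::real. F (of_real u) * exp (- 2 * of_real pi * \<i> * of_int m * of_real u)) =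
      exp (2 * of_real pi * \<i> * of_real ((of_int m - y) * x)) * of_real (exp (- pi * (of_int m - y)\<^sup>2 / t) / sqrt t)" for m
    unfolding F_eq
  proof (rule integral_periodization)
    show "continuous_on UNIV (f m)" unfolding f_def by (intro continuous_intros)
    have "uniform_limit {-1/2..1/2::real}
       (\<lambda>N u. \<Sum>n\<in>{- int N..int N}. gauss_term a (b (of_real u)) (c m (of_real u)) n)
       (\<lambda>u. \<Sum>\<^sub>\<infinity>n. gauss_term a (b (of_real u)) (c m (of_real u)) n) sequentially"
      by (rule uniform_limit_gauss_sum) (use a in \<open>auto simp: b_def c_def intro!: continuous_intros\<close>)
    thus "uniform_limit {-1/2..1/2} (\<lambda>N u. \<Sum>n\<in>{- int N..int N}. f m (u + of_int n))
       (\<lambda>u. \<Sum>\<^sub>\<infinity>n. gauss_term a (b (of_real u)) (c m (of_real u)) n) sequentially"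
      by (simp only: gt)
    \<comment> \<open>The Gaussian in \<open>f m\<close> is centred at -x. Translating by x reduces
      to the centred transform at frequency m - y, at the cost of the factor exp(2 pi i (m - y)
      x).\<close>
    have "has_bochner_integral lborel (\<lambda>u. exp (of_real (- pi * t * (x + 1 * u)\<^sup>2)
            - 2 * of_real pi * \<i> * of_real (of_int m - y) * of_real (x + 1 * u)))
           (of_real (exp (- pi * (of_int m - y)\<^sup>2 / t) / sqrt t) /\<^sub>R \<bar>1\<bar> :: complex)"
      using has_bochner_integral_gaussian_fourier [OF t, of "of_int m - y"]
      by (subst (asm) lborel_has_bochner_integral_real_affine_iff [where c = 1 and t = x]) auto
    hence "has_bochner_integral lborel (\<lambda>u. exp (2 * of_real pi * \<i> * of_real ((of_int m - y) * x)) *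
            exp (of_real (- pi * t * (x + 1 * u)\<^sup>2) - 2 * of_real pi * \<i> * of_real (of_int m - y) * of_real (x + 1 * u)))
        (exp (2 * of_real pi * \<i> * of_real ((of_int m - y) * x)) * (of_real (exp (- pi * (of_int m - y)\<^sup>2 / t) / sqrt t) /\<^sub>R \<bar>1\<bar>))"
      by (intro has_bochner_integral_mult_right) auto
    moreover have "exp (2 * of_real pi * \<i> * of_real ((of_int m - y) * x)) *
            exp (of_real (- pi * t * (x + 1 * u)\<^sup>2) - 2 * of_real pi * \<i> * of_real (of_int m - y) * of_real (x + 1 * u)) = f m u" for u
      unfolding f_def
      by (subst exp_add [symmetric], rule arg_cong [of _ _ exp]) (simp add: power2_eq_square algebra_simps)
    ultimately show "has_bochner_integral lborel (f m)
        (exp (2 * of_real pi * \<i> * of_real ((of_int m - y) * x)) * of_real (exp (- pi * (of_int m - y)\<^sup>2 / t) / sqrt t))"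
      by simp
  qed
  moreover have "exp (2 * of_real pi * \<i> * of_real ((of_int m - y) * x)) * of_real (exp (- pi * (of_int m - y)\<^sup>2 / t) / sqrt t) =
     exp (- 2 * of_real pi * \<i> * of_real (x * y)) / of_real (sqrt t) *
     exp (of_real pi * \<i> * (\<i> / of_real t) * (of_int m + of_real (- y))\<^sup>2 + 2 * of_real pi * \<i> * of_int m * of_real x)" for m
  proof -
    define X where "X = - pi * (of_int m - y)\<^sup>2 / t"
    have 1: "of_real X = of_real pi * \<i> * (\<i> / of_real t) * (of_int m + of_real (- y))\<^sup>2"
    proof -
      have "of_real pi * \<i> * \<i> = - complex_of_real pi" by (simp add: mult.assoc)
      thus ?thesis by (simp add: X_def)
    qed
    have "exp (2 * of_real pi * \<i> * of_real ((of_int m - y) * x)) * exp (of_real X) =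
      exp (- 2 * of_real pi * \<i> * of_real (x * y)) *
      exp (of_real pi * \<i> * (\<i> / of_real t) * (of_int m + of_real (- y))\<^sup>2 + 2 * of_real pi * \<i> * of_int m * of_real x)"
      unfolding 1 exp_add [symmetric] by (rule arg_cong [of _ _ exp]) (simp add: algebra_simps)
    thus ?thesis unfolding X_def [symmetric] by (simp only: of_real_divide exp_of_real times_divide_eq_right times_divide_eq_left)
  qed
  ultimately have "(\<lambda>N. exp (- 2 * of_real pi * \<i> * of_real (x * y)) / of_real (sqrt t) *
      (\<Sum>m\<in>{- int N..int N}. exp (of_real pi * \<i> * (\<i> / of_real t) * (of_int m + of_real (- y))\<^sup>2 + 2 * of_real pi * \<i> * of_int m * of_real x))) \<longlonglongrightarrow> F 0"
    by (simp only: sum_distrib_left)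
  moreover have "(\<lambda>N. \<Sum>m\<in>{- int N..int N}. exp (of_real pi * \<i> * (\<i> / of_real t) * (of_int m + of_real (- y))\<^sup>2 + 2 * of_real pi * \<i> * of_int m * of_real x))
      \<longlonglongrightarrow> theta (- y) x (\<i> / of_real t)"
    using has_sum_theta [of "\<i> / of_real t" "- y" x] t unfolding has_sum_def
    by (intro filterlim_compose [OF _ filterlim_symmetric_int_intervals]) (auto simp: Im_divide_of_real)
  hence "(\<lambda>N. exp (- 2 * of_real pi * \<i> * of_real (x * y)) / of_real (sqrt t) *
      (\<Sum>m\<in>{- int N..int N}. exp (of_real pi * \<i> * (\<i> / of_real t) * (of_int m + of_real (- y))\<^sup>2 + 2 * of_real pi * \<i> * of_int m * of_real x)))
      \<longlonglongrightarrow> exp (- 2 * of_real pi * \<i> * of_real (x * y)) / of_real (sqrt t) * theta (- y) x (\<i> / of_real t)"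
    by (intro tendsto_mult tendsto_const)
  ultimately have "F 0 = exp (- 2 * of_real pi * \<i> * of_real (x * y)) / of_real (sqrt t) * theta (- y) x (\<i> / of_real t)"
    using LIMSEQ_unique by blast
  moreover have "F 0 = theta x y (\<i> * of_real t)"
    unfolding F_def theta_conv_gauss_sum
    by (intro arg_cong2 [of _ _ _ _ infsum] ext refl) (simp add: gauss_term_def a_def b_def c_def algebra_simps)
  ultimately show ?thesis by simp
qed

text \<open>Both sides are holomorphic on the upper half-plane, where -i w has positive real part
  and thus avoids the branch cut of \<open>csqrt\<close>. They agree on the imaginary axis, which
  accumulates at i, so the identity theorem applies.\<close>

theorem theta_inversion:
  assumes w: "Im w > 0"
  shows "theta x y w = exp (- 2 * of_real pi * \<i> * of_real (x * y)) / csqrt (- \<i> * w) * theta (- y) x (- 1 / w)"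
proof -
  define S where "S = {w. Im w > 0}"
  define U where "U = (\<lambda>t. \<i> * complex_of_real t) ` {0<..}"
  define f where "f w = theta x y w - exp (- 2 * of_real pi * \<i> * of_real (x * y)) / csqrt (- \<i> * w) * theta (- y) x (- 1 / w)" for w
  have S: "open S" "connected S"
    unfolding S_def by (auto simp: open_halfspace_Im_gt intro!: convex_connected convex_halfspace_Im_gt)
  have im: "Im (1 / w) < 0" "w \<noteq> 0" if "Im w > 0" for w
    using that by (auto simp: Im_divide divide_simps sum_power2_gt_zero_iff)
  have hol: "f holomorphic_on S"
    unfolding f_def
    by (intro holomorphic_intros S) (auto simp: S_def im complex_nonpos_Reals_iff)
  have lim: "\<i> islimpt U"
  proof (rule islimpt_approachable [THEN iffD2], safe)
    fix e :: real assume "e > 0"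
    hence "\<i> * complex_of_real (1 + e / 2) \<in> U"
      unfolding U_def by (intro imageI) auto
    with \<open>e > 0\<close> show "\<exists>x'\<in>U. x' \<noteq> \<i> \<and> dist x' \<i> < e"
      by (intro bexI [of _ "\<i> * complex_of_real (1 + e / 2)"])
         (auto simp: dist_norm algebra_simps norm_mult)
  qed
  have zero: "f z = 0" if "z \<in> U" for z
  proof -
    from that obtain t where t: "t > 0" "z = \<i> * of_real t" by (auto simp: U_def)
    have "- \<i> * z = of_real t" "- 1 / z = \<i> / of_real t"
      using t by (auto simp: field_simps)
    thus ?thesis
      unfolding f_def using poisson_summation_gaussian [OF t(1), of x y] t by simp
  qed
  have "U \<subseteq> S" "\<i> \<in> S" "w \<in> S" using w by (auto simp: S_def U_def)
  hence "f w = 0"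
    using analytic_continuation [OF hol S _ _ lim zero] by blast
  thus ?thesis by (simp add: f_def)
qed

section \<open>Theta series under translations and lower triangular maps\<close>

lemma has_sum_finite_sum:
  fixes f :: "'b \<Rightarrow> 'a \<Rightarrow> 'c :: topological_comm_monoid_add"
  assumes "\<And>s. s \<in> I \<Longrightarrow> (f s has_sum S s) A"
  shows "((\<lambda>x. \<Sum>s\<in>I. f s x) has_sum (\<Sum>s\<in>I. S s)) A"
  using assms by (induction I rule: infinite_finite_induct) (auto intro: has_sum_add)

text \<open>A positive factor respects the principal branch. This splits off sqrt(\<kappa>) and
  leaves an automorphy factor that is the same for every modulus.\<close>

lemma csqrt_of_real_mult:
  assumes "c > 0"
  shows "csqrt (of_real c * z) = of_real (sqrt c) * csqrt z"
proof (rule csqrt_unique)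
  show "(of_real (sqrt c) * csqrt z)\<^sup>2 = of_real c * z"
    using assms by (simp add: power_mult_distrib flip: of_real_power)
  show "0 < Re (of_real (sqrt c) * csqrt z) \<or>
    Re (of_real (sqrt c) * csqrt z) = 0 \<and> 0 \<le> Im (of_real (sqrt c) * csqrt z)"
    using csqrt_principal [of z] assms by (auto simp del: csqrt.simps)
qed

lemma sum_roots_of_unity:
  assumes M: "M > 0"
  shows "(\<Sum>s<M. exp (2 * of_real pi * \<i> * of_int d * of_nat s / of_nat M)) =
         (if int M dvd d then of_nat M else 0 :: complex)"
proof -
  define w :: complex where "w = exp (2 * of_real pi * \<i> * of_int d / of_nat M)"
  have pow: "exp (2 * of_real pi * \<i> * of_int d * of_nat s / of_nat M) = w ^ s" for s
    unfolding w_def exp_of_nat_mult [symmetric] by (simp add: mult_ac)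
  have "w ^ M = exp (2 * of_real pi * \<i> * of_int d)"
    unfolding pow [symmetric] using M by simp
  hence wM: "w ^ M = 1" by simp
  have "w = 1 \<longleftrightarrow> int M dvd d"
  proof
    assume "w = 1"
    then obtain n :: int where "2 * pi * of_int d / of_nat M = of_int (2 * n) * pi"
      unfolding w_def exp_eq_1 by (auto simp: Im_divide_of_nat)
    hence "real_of_int d = of_int (n * int M)" using M by (simp add: field_simps)
    hence "d = n * int M" by (simp only: of_int_eq_iff)
    thus "int M dvd d" by simp
  next
    assume "int M dvd d"
    then obtain n where "d = int M * n" ..
    hence "2 * of_real pi * \<i> * of_int d / of_nat M = 2 * of_real pi * \<i> * complex_of_int n"
      using M by simp
    thus "w = 1" by (simp only: w_def exp_2pi_int)
  qed
  thus ?thesis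
    using wM unfolding pow by (auto simp: geometric_sum)
qed

text \<open>Inversion on the integers modulo M by orthogonality of the characters.\<close>

lemma finite_fourier_expansion:
  fixes h :: "int \<Rightarrow> complex"
  assumes M: "M > 0" and per: "\<And>m l. int M dvd m - l \<Longrightarrow> h m = h l"
  obtains u where "\<And>m. h m = (\<Sum>s<M. u s * exp (2 * of_real pi * \<i> * of_int m * of_nat s / of_nat M))"
proof
  fix m
  define e :: "int \<Rightarrow> nat \<Rightarrow> complex" where "e m s = exp (2 * of_real pi * \<i> * of_int m * of_nat s / of_nat M)" for m s
  have "(\<Sum>s<M. ((\<Sum>l<M. h (int l) * e (- int l) s) / of_nat M) * e m s) =
      (\<Sum>s<M. \<Sum>l<M. h (int l) / of_nat M * e (m - int l) s)"
    unfolding sum_divide_distrib sum_distrib_right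
  proof (intro sum.cong refl)
    fix s l
    have "e (- int l) s * e m s = e (m - int l) s"
      unfolding e_def exp_add [symmetric]
      by (rule arg_cong [of _ _ exp]) (simp add: ring_distribs diff_divide_distrib)
    thus "h (int l) * e (- int l) s / of_nat M * e m s = h (int l) / of_nat M * e (m - int l) s"
      by (simp add: mult.assoc)
  qed
  also have "\<dots> = (\<Sum>l<M. h (int l) / of_nat M * (\<Sum>s<M. e (m - int l) s))"
    by (subst sum.swap) (simp add: sum_distrib_left)
  also have "\<dots> = (\<Sum>l<M. if l = nat (m mod int M) then h m else 0)"
  proof (intro sum.cong refl)
    fix l assume "l \<in> {..<M}"
    hence "int M dvd m - int l \<longleftrightarrow> l = nat (m mod int M)"
      by (auto simp: mod_eq_dvd_iff [symmetric] mod_pos_pos_trivial)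
    thus "h (int l) / of_nat M * (\<Sum>s<M. e (m - int l) s) = (if l = nat (m mod int M) then h m else 0)"
      using M per [of m "int l"] unfolding e_def sum_roots_of_unity [OF M] by auto
  qed
  also have "\<dots> = h m" using M by (simp add: nat_less_iff)
  finally show "h m = (\<Sum>s<M. ((\<Sum>l<M. h (int l) * e (- int l) s) / of_nat M) * exp (2 * of_real pi * \<i> * of_int m * of_nat s / of_nat M))"
    by (simp add: e_def)
qed

section \<open>Effect of the maps w / (1 + 2 n w) on theta series\<close>

lemma Im_lower_triangular:
  fixes n :: int
  assumes w: "Im w > 0"
  shows "1 + 2 * of_int n * w \<noteq> 0" "Im (w / (1 + 2 * of_int n * w)) > 0"
proof -
  show nz: "1 + 2 * of_int n * w \<noteq> 0"
    using w by (auto simp: complex_eq_iff)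
  have "Im (w / (1 + 2 * of_int n * w)) = Im w / (cmod (1 + 2 * of_int n * w))\<^sup>2"
    by (simp add: Im_divide cmod_power2) (simp add: algebra_simps)
  thus "Im (w / (1 + 2 * of_int n * w)) > 0" using w nz by simp
qed

lemma Im_neg_inverse: "Im w > 0 \<Longrightarrow> Im (- 1 / w) > 0"
  by (auto simp: Im_divide divide_simps sum_power2_gt_zero_iff)

text \<open>The sign (-1)^n becomes the shift -1/2 on the dual side, and the shift x becomes a
  character. All dependence on w outside the theta series sits in
  \<open>csqrt (- \<i> * w)\<close>.\<close>

lemma theta_half_dual:
  assumes \<kappa>: "\<kappa> > 0" and w: "Im w > 0"
  shows "theta x (1/2) (of_real \<kappa> * w) =
     exp (- of_real pi * \<i> * of_real x) / (of_real (sqrt \<kappa>) * csqrt (- \<i> * w)) * theta (- (1/2)) x (- 1 / (of_real \<kappa> * w))"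
proof -
  have "- \<i> * (of_real \<kappa> * w) = of_real \<kappa> * (- \<i> * w)" by simp
  moreover have "- 2 * of_real pi * \<i> * of_real (x * (1/2)) = - of_real pi * \<i> * complex_of_real x" by simp
  ultimately show ?thesis
    using theta_inversion [of "of_real \<kappa> * w" x "1/2"] assms
    by (simp only: csqrt_of_real_mult [OF \<kappa>]) simp
qed

text \<open>The dual series is left expanded because the phase varies with m. It is resolved in two
  ways below: by Fourier expansion for the numerators, and by a symmetry for eta.\<close>

lemma theta_half_lower_triangular:
  fixes n :: int
  assumes \<kappa>: "\<kappa> > 0" and w: "Im w > 0"
  defines "w' \<equiv> w / (1 + 2 * of_int n * w)"
  shows "theta x (1/2) (of_real \<kappa> * w') =
     exp (- of_real pi * \<i> * of_real x) / (of_real (sqrt \<kappa>) * csqrt (- \<i> * w')) *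
     (\<Sum>\<^sub>\<infinity>m. exp (- 2 * of_real pi * \<i> * of_int n * (of_int m + of_real (- (1/2)))\<^sup>2 / of_real \<kappa>) *
        exp (of_real pi * \<i> * (- 1 / (of_real \<kappa> * w)) * (of_int m + of_real (- (1/2)))\<^sup>2 + 2 * of_real pi * \<i> * of_int m * of_real x))"
proof -
  have nz: "1 + 2 * of_int n * w \<noteq> 0" "w \<noteq> 0" "Im w' > 0"
    using Im_lower_triangular [OF w] w by (auto simp: w'_def)
  have inv: "- 1 / (of_real \<kappa> * w') = - 1 / (of_real \<kappa> * w) - 2 * of_int n / of_real \<kappa>"
    using nz \<kappa> by (simp add: w'_def field_simps)
  have "theta (- (1/2)) x (- 1 / (of_real \<kappa> * w')) =
     (\<Sum>\<^sub>\<infinity>m. exp (- 2 * of_real pi * \<i> * of_int n * (of_int m + of_real (- (1/2)))\<^sup>2 / of_real \<kappa>) *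
        exp (of_real pi * \<i> * (- 1 / (of_real \<kappa> * w)) * (of_int m + of_real (- (1/2)))\<^sup>2 + 2 * of_real pi * \<i> * of_int m * of_real x))"
    unfolding theta_def inv exp_add [symmetric]
    by (intro infsum_cong arg_cong [of _ _ exp]) (simp add: ring_distribs diff_divide_distrib)
  thus ?thesis unfolding theta_half_dual [OF \<kappa> nz(3)] by simp
qed

text \<open>Dualize, expand the product of phase and character into characters modulo M, and dualize
  each term back. The coefficients \<open>u\<close> are fixed before w, as membership in a span of
  functions requires.\<close>

lemma theta_family_lower_triangular:
  fixes n r :: int and M :: nat
  assumes M: "M > 0"
  obtains u where "\<And>w. Im w > 0 \<Longrightarrow> theta (of_int r / of_nat M) (1/2) (of_nat M * (w / (1 + 2 * of_int n * w))) =
     csqrt (- \<i> * w) / csqrt (- \<i> * (w / (1 + 2 * of_int n * w))) * (\<Sum>s<M. u s * theta (of_nat s / of_nat M) (1/2) (of_nat M * w))"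
proof -
  define x where "x = real_of_int r / of_nat M"
  define h where "h m = exp (- 2 * of_real pi * \<i> * of_int n * (of_int m + of_real (- (1/2)))\<^sup>2 / of_real (of_nat M)) *
        exp (2 * of_real pi * \<i> * of_int m * of_real x)" for m :: int
  \<comment> \<open>For m = l + M j the difference of the squares (m - 1/2)^2 and (l - 1/2)^2,
    divided by M, is j (2l + M j - 1), an integer; the factor 2 n in the phase turns it into a full
    period. The character with x = r/M contributes the integer j r.\<close>
  have per: "h m = h l" if "int M dvd m - l" for m l
  proof -
    from that obtain j where j: "m = l + int M * j"
      by (metis add.commute diff_add_cancel dvdE)
    have "h m = h l * exp (2 * of_real pi * \<i> * of_int (- n * j * (2 * l + int M * j - 1) + j * r))"
      unfolding h_def exp_add [symmetric] using M
      by (intro arg_cong [of _ _ exp]) (simp add: j x_def power2_eq_square field_simps)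
    thus ?thesis by (simp only: exp_2pi_int mult_1_right)
  qed
  obtain v where v: "\<And>m. h m = (\<Sum>s<M. v s * exp (2 * of_real pi * \<i> * of_int m * of_nat s / of_nat M))"
    using finite_fourier_expansion [of M h, OF M per] by blast
  \<comment> \<open>The first exponential comes from dualizing the given series, the last one undoes
    the corresponding factor when the term with shift s/M is dualized back.\<close>
  define u where "u s = exp (- of_real pi * \<i> * of_real x) * v s * exp (of_real pi * \<i> * of_real (of_nat s / of_nat M))" for s
  show ?thesis
  proof (rule that)
    fix w :: complex assume w: "Im w > 0"
    define w' where "w' = w / (1 + 2 * of_int n * w)"
    define E where "E y m = exp (of_real pi * \<i> * (- 1 / (of_real (of_nat M) * w)) * (of_int m + of_real (- (1/2)))\<^sup>2 +
        2 * of_real pi * \<i> * of_int m * of_real y)" for y :: real and m :: int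
    have M': "real M > 0" using M by simp
    have w0: "w \<noteq> 0" using w by auto
    have dual: "(E y has_sum theta (- (1/2)) y (- 1 / (of_real (of_nat M) * w))) UNIV" for y
      unfolding E_def using w M' by (intro has_sum_theta Im_neg_inverse) auto
    have "(\<Sum>\<^sub>\<infinity>m. exp (- 2 * of_real pi * \<i> * of_int n * (of_int m + of_real (- (1/2)))\<^sup>2 / of_real (of_nat M)) * E x m) =
        (\<Sum>\<^sub>\<infinity>m. \<Sum>s<M. v s * E (of_nat s / of_nat M) m)"
    proof (intro infsum_cong)
      fix m
      have E: "E y m = exp (of_real pi * \<i> * (- 1 / (of_real (of_nat M) * w)) * (of_int m + of_real (- (1/2)))\<^sup>2) *
         exp (2 * of_real pi * \<i> * of_int m * of_real y)" for y
        by (simp only: E_def exp_add)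
      have "exp (- 2 * of_real pi * \<i> * of_int n * (of_int m + of_real (- (1/2)))\<^sup>2 / of_real (of_nat M)) * E x m =
          exp (of_real pi * \<i> * (- 1 / (of_real (of_nat M) * w)) * (of_int m + of_real (- (1/2)))\<^sup>2) * h m"
        unfolding E h_def by (simp only: mult_ac)
      also have "\<dots> = (\<Sum>s<M. v s * E (of_nat s / of_nat M) m)"
        unfolding v sum_distrib_left E by (intro sum.cong refl) (simp add: mult_ac)
      finally show "exp (- 2 * of_real pi * \<i> * of_int n * (of_int m + of_real (- (1/2)))\<^sup>2 / of_real (of_nat M)) * E x m =
          (\<Sum>s<M. v s * E (of_nat s / of_nat M) m)" .
    qed
    also have "\<dots> = (\<Sum>s<M. v s * theta (- (1/2)) (of_nat s / of_nat M) (- 1 / (of_real (of_nat M) * w)))"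
      by (intro infsumI has_sum_finite_sum has_sum_cmult_right dual)
    also have "\<dots> = of_real (sqrt M) * csqrt (- \<i> * w) *
      (\<Sum>s<M. v s * exp (of_real pi * \<i> * of_real (of_nat s / of_nat M)) * theta (of_nat s / of_nat M) (1/2) (of_real (of_nat M) * w))"
      unfolding sum_distrib_left
    proof (intro sum.cong refl)
      fix s
      have *: "T = c * (e * (inverse e / c * T))" if "c \<noteq> 0" "e \<noteq> 0" for T c e :: complex
        using that by simp
      show "v s * theta (- (1/2)) (of_nat s / of_nat M) (- 1 / (of_real (of_nat M) * w)) =
        of_real (sqrt M) * csqrt (- \<i> * w) *
        (v s * exp (of_real pi * \<i> * of_real (of_nat s / of_nat M)) * theta (of_nat s / of_nat M) (1/2) (of_real (of_nat M) * w))"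
        unfolding theta_half_dual [OF M' w] using M' w0 
          * [of "of_real (sqrt M) * csqrt (- \<i> * w)" "exp (of_real pi * \<i> * of_real (of_nat s / of_nat M))"
             "theta (- (1/2)) (of_nat s / of_nat M) (- 1 / (of_real (of_nat M) * w))"]
        by (simp add: exp_minus mult_ac)
    qed
    finally have "theta x (1/2) (of_real (of_nat M) * w') =
       exp (- of_real pi * \<i> * of_real x) / (of_real (sqrt M) * csqrt (- \<i> * w')) *
       (of_real (sqrt M) * csqrt (- \<i> * w) *
      (\<Sum>s<M. v s * exp (of_real pi * \<i> * of_real (of_nat s / of_nat M)) * theta (of_nat s / of_nat M) (1/2) (of_real (of_nat M) * w)))"
      using theta_half_lower_triangular [OF M' w, of x n] unfolding w'_def E_def by (simp only:)
    also have "\<dots> = csqrt (- \<i> * w) / csqrt (- \<i> * w') * (\<Sum>s<M. u s * theta (of_nat s / of_nat M) (1/2) (of_real (of_nat M) * w))"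
      using M' unfolding u_def mult.assoc sum_distrib_left [symmetric] by (simp add: field_simps del: csqrt.simps)
    finally show "theta (of_int r / of_nat M) (1/2) (of_nat M * (w / (1 + 2 * of_int n * w))) =
     csqrt (- \<i> * w) / csqrt (- \<i> * (w / (1 + 2 * of_int n * w))) * (\<Sum>s<M. u s * theta (of_nat s / of_nat M) (1/2) (of_nat M * w))"
      by (simp add: x_def w'_def)
  qed
qed

lemma infsum_eq_0_if_odd:
  fixes b :: "int \<Rightarrow> complex"
  assumes "\<And>m. b (c - m) = - b m"
  shows "infsum b UNIV = 0"
proof -
  have "bij (\<lambda>m. c - m)"
    by (rule bij_betw_byWitness [where f' = "\<lambda>m. c - m"]) auto
  hence "infsum b UNIV = (\<Sum>\<^sub>\<infinity>m. b (c - m))"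
    by (rule infsum_reindex_bij_betw [symmetric])
  thus ?thesis by (simp add: assms infsum_uminus)
qed

text \<open>Since (m - 1/2)^2 = m (m - 1) + 1/4 and 3 divides m (m - 1) unless m is 2 modulo 3, the
  phase has the constant value \<open>\<omega>0\<close> on the other two classes. Within the class
  of 2 the reflection m -> 1 - m keeps the square and negates the character with x = 1/6, so that
  class adds nothing with either phase. Hence eta is only multiplied by \<open>\<omega>0\<close> and
  the automorphy factor.\<close>

lemma eta_theta_lower_triangular:
  fixes n :: int
  assumes w: "Im w > 0"
  defines "w' \<equiv> w / (1 + 2 * of_int n * w)"
  shows "theta (1/6) (1/2) (3 * w') =
     csqrt (- \<i> * w) / csqrt (- \<i> * w') * (exp (- of_real pi * \<i> * of_int n / 6) * theta (1/6) (1/2) (3 * w))"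
proof -
  define E where "E m = exp (of_real pi * \<i> * (- 1 / (of_real 3 * w)) * (of_int m + of_real (- (1/2)))\<^sup>2 +
        2 * of_real pi * \<i> * of_int m * of_real (1/6))" for m :: int
  define \<omega> where "\<omega> m = exp (- 2 * of_real pi * \<i> * of_int n * (of_int m + of_real (- (1/2)))\<^sup>2 / of_real 3)" for m :: int
  define \<omega>0 where "\<omega>0 = exp (- of_real pi * \<i> * of_int n / 6)"
  \<comment> \<open>The error made by replacing the phase with the constant: it vanishes outside the
    class of 2 modulo 3 and is odd under m -> 1 - m, so its sum is zero.\<close>
  define b where "b m = (\<omega> m - \<omega>0) * E m" for m
  have w3: "Im (of_real 3 * w) > 0" using w by simp
  have E_sum: "(E has_sum theta (- (1/2)) (1/6) (- 1 / (of_real 3 * w))) UNIV"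
    unfolding E_def by (intro has_sum_theta Im_neg_inverse w3)
  have \<omega>: "\<omega> m = \<omega>0" if "\<not> m mod 3 = 2" for m
  proof -
    have "3 dvd m * (m - 1)"
    proof -
      have "m mod 3 = 0 \<or> m mod 3 = 1" using that by presburger
      hence "3 dvd m \<or> 3 dvd (m - 1)" by presburger
      thus ?thesis by auto
    qed
    then obtain l where l: "m * (m - 1) = 3 * l" ..
    have l': "of_int m * (of_int m - 1) = (3 * of_int l :: complex)"
      using arg_cong [OF l, of "of_int :: int \<Rightarrow> complex"] by simp
    have "(of_int m + of_real (- (1/2)))\<^sup>2 = of_int m * (of_int m - 1) + (1 / 4 :: complex)"
      by (simp add: power2_eq_square field_simps)
    hence sq: "(of_int m + of_real (- (1/2)))\<^sup>2 = (3 * of_int l + 1 / 4 :: complex)"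
      using l' by simp
    have "\<omega> m = \<omega>0 * exp (2 * of_real pi * \<i> * of_int (- n * l))"
      unfolding \<omega>_def \<omega>0_def exp_add [symmetric] sq
      by (rule arg_cong [of _ _ exp]) (simp add: field_simps)
    thus ?thesis by (simp only: exp_2pi_int mult_1_right)
  qed
  have b: "b (1 - m) = - b m" for m
  proof (cases "m mod 3 = 2")
    case False
    hence "\<not> (1 - m) mod 3 = 2" by presburger
    thus ?thesis using \<omega> False by (simp add: b_def)
  next
    case True
    then obtain l where l: "m = 3 * l + 2"
      by (metis add.commute mult_div_mod_eq)
    have sq: "(of_int (1 - m) + of_real (- (1/2)))\<^sup>2 = (of_int m + complex_of_real (- (1/2)))\<^sup>2"
      by (simp add: power2_eq_square algebra_simps)
    \<comment> \<open>For m = 3 l + 2 the characters at 1 - m and at m differ by the factor exp(pi i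
      (1 - 2m) / 3) = exp(-pi i (2l + 1)) = -1.\<close>
    have "E (1 - m) = E m * exp (2 * of_real pi * \<i> * of_int (- l - 1)) * exp (of_real pi * \<i>)"
      unfolding E_def sq exp_add [symmetric]
      by (rule arg_cong [of _ _ exp]) (simp add: l field_simps)
    hence "E (1 - m) = - E m" by (simp only: exp_2pi_int mult_1_right exp_pi_i mult_minus_right)
    moreover have "\<omega> (1 - m) = \<omega> m" unfolding \<omega>_def sq ..
    ultimately show ?thesis by (simp add: b_def)
  qed
  have summ: "(\<lambda>m. \<omega>0 * E m) summable_on UNIV" "(\<lambda>m. \<omega> m * E m) summable_on UNIV"
  proof -
    show "(\<lambda>m. \<omega>0 * E m) summable_on UNIV"
      by (intro summable_on_cmult_right has_sum_imp_summable [OF E_sum])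
    have "(\<lambda>m. norm (E m)) summable_on UNIV"
      unfolding E_def by (intro abs_summable_on_theta Im_neg_inverse [OF w3])
    moreover have "norm (\<omega> m * E m) \<le> norm (E m)" for m
    proof -
      have "\<omega> m = exp (\<i> * of_real (- 2 * pi * of_int n * (of_int m - 1/2)\<^sup>2 / 3))"
        unfolding \<omega>_def by (rule arg_cong [of _ _ exp]) simp
      hence "norm (\<omega> m) = 1" by (simp only: norm_exp_i_times)
      thus ?thesis by (simp add: norm_mult)
    qed
    ultimately have "(\<lambda>m. norm (\<omega> m * E m)) summable_on UNIV"
      by (rule Infinite_Sum.abs_summable_on_comparison_test')
    thus "(\<lambda>m. \<omega> m * E m) summable_on UNIV"
      by (rule Infinite_Sum.abs_summable_summable)
  qed
  have "(\<Sum>\<^sub>\<infinity>m. \<omega> m * E m) = (\<Sum>\<^sub>\<infinity>m. \<omega>0 * E m)"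
  proof -
    have "(\<lambda>m. b m) summable_on UNIV"
      using summable_on_add [OF summ(2) summable_on_uminus [THEN iffD2, OF summ(1)]]
      by (simp add: b_def ring_distribs)
    hence "infsum (\<lambda>m. b m + \<omega>0 * E m) UNIV = infsum b UNIV + (\<Sum>\<^sub>\<infinity>m. \<omega>0 * E m)"
      by (intro infsum_add summ)
    moreover have "infsum b UNIV = 0" using infsum_eq_0_if_odd [of b 1] b by simp
    moreover have "(\<lambda>m. b m + \<omega>0 * E m) = (\<lambda>m. \<omega> m * E m)" by (simp add: b_def algebra_simps fun_eq_iff)
    ultimately show ?thesis by simp
  qed
  also have "\<dots> = \<omega>0 * theta (- (1/2)) (1/6) (- 1 / (of_real 3 * w))"
    by (intro infsumI has_sum_cmult_right E_sum)
  finally have "(\<Sum>\<^sub>\<infinity>m. \<omega> m * E m) = \<omega>0 * theta (- (1/2)) (1/6) (- 1 / (of_real 3 * w))" .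
  hence "theta (1/6) (1/2) (of_real 3 * w') =
      exp (- of_real pi * \<i> * of_real (1/6)) / (of_real (sqrt 3) * csqrt (- \<i> * w')) *
      (\<omega>0 * theta (- (1/2)) (1/6) (- 1 / (of_real 3 * w)))"
    using theta_half_lower_triangular [of 3 w "1/6" n] w unfolding w'_def E_def \<omega>_def by (simp only: zero_less_numeral)
  moreover have "theta (1/6) (1/2) (of_real 3 * w) =
     exp (- of_real pi * \<i> * of_real (1/6)) / (of_real (sqrt 3) * csqrt (- \<i> * w)) * theta (- (1/2)) (1/6) (- 1 / (of_real 3 * w))"
    by (rule theta_half_dual) (use w in auto)
  moreover have "csqrt (- \<i> * w) \<noteq> 0" using w by auto
  moreover have "x = c / c' * (v * y)" if "x = e / (s * c') * (v * z)" "y = e / (s * c) * z" "c \<noteq> 0"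
    for x y z c c' e s v :: complex
    using that by (simp add: mult_ac)
  ultimately have "theta (1/6) (1/2) (of_real 3 * w') =
      csqrt (- \<i> * w) / csqrt (- \<i> * w') * (\<omega>0 * theta (1/6) (1/2) (of_real 3 * w))"
    by blast
  thus ?thesis by (simp only: \<omega>0_def of_real_numeral)
qed

text \<open>The substitution n -> -1 - n preserves the square and changes the parity of n. In
  particular the series with x = 1/2 vanishes.\<close>

lemma theta_half_reflect: "theta (1 - x) (1/2) t = - theta x (1/2) t"
proof -
  define f where "f x n = exp (of_real pi * \<i> * t * (of_int n + of_real x)\<^sup>2 + 2 * of_real pi * \<i> * of_int n * of_real (1/2))" for x and n :: int
  have f: "f (1 - x) (- 1 - n) = - f x n" for n
  proof -
    have sq: "(of_int (- 1 - n) + of_real (1 - x))\<^sup>2 = (of_int n + complex_of_real x)\<^sup>2"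
      by (simp add: power2_eq_square algebra_simps)
    have "f (1 - x) (- 1 - n) = f x n * exp (2 * of_real pi * \<i> * of_int (- n - 1)) * exp (of_real pi * \<i>)"
      unfolding f_def sq exp_add [symmetric]
      by (rule arg_cong [of _ _ exp]) (simp add: field_simps)
    thus ?thesis by (simp only: exp_2pi_int mult_1_right exp_pi_i mult_minus_right)
  qed
  have "bij (\<lambda>n::int. - 1 - n)"
    by (rule bij_betw_byWitness [where f' = "\<lambda>m. - 1 - m"]) auto
  hence "theta (1 - x) (1/2) t = (\<Sum>\<^sub>\<infinity>n. f (1 - x) (- 1 - n))"
    unfolding theta_def f_def [symmetric] by (rule infsum_reindex_bij_betw [symmetric])
  also have "\<dots> = - theta x (1/2) t"
    unfolding f infsum_uminus by (simp add: theta_def f_def)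
  finally show ?thesis .
qed

text \<open>Expanding 2k (j + r/(2k))^2 leaves the even integer 2 (k j^2 + j r) besides the constant
  r^2/(2k); the evenness of the modulus removes any sign depending on j.\<close>

lemma theta_family_translate:
  fixes n r :: int and k :: nat
  assumes k: "k > 0"
  shows "theta (of_int r / of_nat (2 * k)) (1/2) (of_nat (2 * k) * (w + of_int n)) =
     exp (2 * of_real pi * \<i> * of_int n * (of_int r)\<^sup>2 / of_nat (4 * k)) * theta (of_int r / of_nat (2 * k)) (1/2) (of_nat (2 * k) * w)"
  unfolding theta_def infsum_cmult_right' [symmetric]
proof (intro infsum_cong)
  fix j :: int
  define x :: real where "x = of_int r / of_nat (2 * k)"
  define e where "e = exp (2 * of_real pi * \<i> * of_int n * (of_int r)\<^sup>2 / of_nat (4 * k))"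
  have "exp (of_real pi * \<i> * (of_nat (2 * k) * (w + of_int n)) * (of_int j + of_real x)\<^sup>2 + 2 * of_real pi * \<i> * of_int j * of_real (1/2)) =
     e * exp (of_real pi * \<i> * (of_nat (2 * k) * w) * (of_int j + of_real x)\<^sup>2 + 2 * of_real pi * \<i> * of_int j * of_real (1/2)) *
     exp (2 * of_real pi * \<i> * of_int (n * (int k * j\<^sup>2 + j * r)))"
    unfolding e_def exp_add [symmetric] using k
    by (intro arg_cong [of _ _ exp]) (simp add: x_def power2_eq_square field_simps)
  thus "exp (of_real pi * \<i> * (of_nat (2 * k) * (w + of_int n)) * (of_int j + of_real x)\<^sup>2 + 2 * of_real pi * \<i> * of_int j * of_real (1/2)) =
     e * exp (of_real pi * \<i> * (of_nat (2 * k) * w) * (of_int j + of_real x)\<^sup>2 + 2 * of_real pi * \<i> * of_int j * of_real (1/2))"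
    by (simp only: exp_2pi_int mult_1_right)
qed

text \<open>Here the modulus 3 is odd and evenness comes from the shift instead: 3 (j + 1/6)^2 = j
  (3 j + 1) + 1/12, and j (3 j + 1) is always even.\<close>

lemma eta_theta_translate:
  fixes n :: int
  shows "theta (1/6) (1/2) (3 * (w + of_int n)) = exp (of_real pi * \<i> * of_int n / 12) * theta (1/6) (1/2) (3 * w)"
  unfolding theta_def infsum_cmult_right' [symmetric]
proof (intro infsum_cong)
  fix j :: int
  have "even (j * (3 * j + 1))" by simp
  then obtain l where l: "j * (3 * j + 1) = 2 * l" ..
  have l': "of_int l = of_int j * (3 * of_int j + 1) / (2 :: complex)"
    using arg_cong [OF l, of "of_int :: int \<Rightarrow> complex"] by simp
  have "exp (of_real pi * \<i> * (3 * (w + of_int n)) * (of_int j + of_real (1/6))\<^sup>2 + 2 * of_real pi * \<i> * of_int j * of_real (1/2)) =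
     exp (of_real pi * \<i> * of_int n / 12) *
     exp (of_real pi * \<i> * (3 * w) * (of_int j + of_real (1/6))\<^sup>2 + 2 * of_real pi * \<i> * of_int j * of_real (1/2)) *
     exp (2 * of_real pi * \<i> * of_int (n * l))"
    unfolding exp_add [symmetric]
    by (intro arg_cong [of _ _ exp]) (simp add: l' power2_eq_square field_simps)
  thus "exp (of_real pi * \<i> * (3 * (w + of_int n)) * (of_int j + of_real (1/6))\<^sup>2 + 2 * of_real pi * \<i> * of_int j * of_real (1/2)) =
     exp (of_real pi * \<i> * of_int n / 12) *
     exp (of_real pi * \<i> * (3 * w) * (of_int j + of_real (1/6))\<^sup>2 + 2 * of_real pi * \<i> * of_int j * of_real (1/2))"
    by (simp only: exp_2pi_int mult_1_right)
qed

section \<open>The Jacobi triple product\<close>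

definition qpoch :: "complex \<Rightarrow> nat \<Rightarrow> complex" where
  "qpoch q N = (\<Prod>i<N. 1 - q ^ Suc i)"

text \<open>The Gaussian binomial coefficient, written as a quotient because no denominator vanishes
  for |q| < 1. The value 0 for r > M makes the q-Pascal rule hold at r = M.\<close>

definition qbinomial :: "complex \<Rightarrow> nat \<Rightarrow> nat \<Rightarrow> complex" where
  "qbinomial q M r = (if r \<le> M then qpoch q M / (qpoch q r * qpoch q (M - r)) else 0)"

lemma qpoch_0 [simp]: "qpoch q 0 = 1"
  by (simp add: qpoch_def)

lemma qpoch_Suc: "qpoch q (Suc N) = qpoch q N * (1 - q ^ Suc N)"
  by (simp add: qpoch_def)

lemma one_minus_power_nonzero:
  fixes q :: complex
  assumes "norm q < 1"
  shows "1 - q ^ Suc i \<noteq> 0"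
proof
  assume "1 - q ^ Suc i = 0"
  hence "norm q ^ Suc i = 1" by (metis eq_iff_diff_eq_0 norm_one norm_power)
  moreover have "norm q * norm q ^ i \<le> norm q"
    using assms by (intro mult_left_le power_le_one) auto
  ultimately show False using assms by simp
qed

lemma qpoch_nonzero: "norm q < 1 \<Longrightarrow> qpoch q N \<noteq> 0"
  unfolding qpoch_def using one_minus_power_nonzero by simp

lemma convergent_prod_one_minus_power:
  fixes q :: complex
  assumes "norm q < 1"
  shows "convergent_prod (\<lambda>i. 1 - q ^ Suc i)"
proof -
  have "summable (\<lambda>i. norm q * norm q ^ i)"
    using assms by (intro summable_mult summable_geometric) auto
  hence "summable (\<lambda>i. norm ((1 - q ^ Suc i) - 1))"
    by (simp add: norm_mult norm_power)
  thus ?thesis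
    using abs_convergent_prod_conv_summable abs_convergent_prod_imp_convergent_prod by blast
qed

lemma qpoch_limit:
  assumes "norm q < 1"
  obtains \<phi> where "\<phi> \<noteq> 0" "qpoch q \<longlonglongrightarrow> \<phi>"
proof
  show "prodinf (\<lambda>i. 1 - q ^ Suc i) \<noteq> 0"
    using convergent_prod_one_minus_power [OF assms] one_minus_power_nonzero [OF assms]
    by (rule prodinf_nonzero)
  have "(\<lambda>n. \<Prod>i\<le>n. 1 - q ^ Suc i) \<longlonglongrightarrow> prodinf (\<lambda>i. 1 - q ^ Suc i)"
    by (rule convergent_prod_LIMSEQ [OF convergent_prod_one_minus_power [OF assms]])
  thus "qpoch q \<longlonglongrightarrow> prodinf (\<lambda>i. 1 - q ^ Suc i)"
    unfolding qpoch_def [abs_def]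
    by (subst (asm) LIMSEQ_lessThan_iff_atMost [symmetric, where f = "\<lambda>S. \<Prod>i\<in>S. 1 - q ^ Suc i"])
qed

lemma qbinomial_0 [simp]: "norm q < 1 \<Longrightarrow> qbinomial q M 0 = 1"
  by (simp add: qbinomial_def qpoch_nonzero)

lemma qbinomial_Suc_Suc:
  assumes q: "norm q < 1" and r: "r \<le> M"
  shows "qbinomial q (Suc M) (Suc r) = qbinomial q M (Suc r) + q ^ (M - r) * qbinomial q M r"
proof (cases "r = M")
  case True
  thus ?thesis by (simp add: qbinomial_def qpoch_nonzero q)
next
  case False
  then obtain d where d: "M = Suc (r + d)" using r
    by (metis le_neq_implies_less less_iff_Suc_add)
  have nz: "qpoch q r \<noteq> 0" "qpoch q d \<noteq> 0" "1 - q ^ Suc r \<noteq> 0" "1 - q ^ Suc d \<noteq> 0"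
    using q qpoch_nonzero one_minus_power_nonzero by blast+
  have "qbinomial q M (Suc r) = qpoch q M / (qpoch q r * (1 - q ^ Suc r) * qpoch q d)"
       "qbinomial q M r = qpoch q M / (qpoch q r * (qpoch q d * (1 - q ^ Suc d)))"
       "qbinomial q (Suc M) (Suc r) = qpoch q M * (1 - q ^ Suc r * q ^ Suc d) / (qpoch q r * (1 - q ^ Suc r) * (qpoch q d * (1 - q ^ Suc d)))"
    using False r by (simp_all add: qbinomial_def qpoch_Suc d Suc_diff_le power_add)
  moreover have "q ^ (M - r) = q ^ Suc d" by (simp add: d)
  moreover have "P * (1 - x * y) / (A * (1 - x) * (B * (1 - y))) =
      P / (A * (1 - x) * B) + y * (P / (A * (B * (1 - y))))"
    if "A \<noteq> 0" "B \<noteq> 0" "1 - x \<noteq> 0" "1 - y \<noteq> 0" for P A B x y :: complex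
    using that by (simp add: divide_simps) (simp add: algebra_simps)
  ultimately show ?thesis
    using nz by (simp only:)
qed

text \<open>Induction by the q-Pascal rule. Raising r by one multiplies q^(r choose 2) by q^r, which
  completes the weight q^(M - r) to the factor q^M of the new term 1 + q^M z.\<close>

lemma qbinomial_theorem:
  assumes q: "norm q < 1"
  shows "(\<Prod>i<M. 1 + q ^ i * z) = (\<Sum>r\<le>M. qbinomial q M r * q ^ (r choose 2) * z ^ r)"
proof (induction M)
  case 0
  thus ?case using q by (simp add: numeral_2_eq_2)
next
  case (Suc M)
  define T where "T r = qbinomial q M r * q ^ (r choose 2) * z ^ r" for r
  have step: "qbinomial q (Suc M) (Suc r) * q ^ (Suc r choose 2) * z ^ Suc r = T (Suc r) + q ^ M * z * T r"
    if "r \<le> M" for r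
  proof -
    have "Suc r choose 2 = r + (r choose 2)"
      by (simp add: numeral_2_eq_2)
    moreover have "q ^ (M - r) * q ^ r = q ^ M"
      using that by (simp flip: power_add)
    ultimately show ?thesis
      using qbinomial_Suc_Suc [OF q that] by (simp add: T_def power_add algebra_simps)
  qed
  have "(\<Sum>r\<le>Suc M. qbinomial q (Suc M) r * q ^ (r choose 2) * z ^ r) =
      1 + (\<Sum>r\<le>M. T (Suc r) + q ^ M * z * T r)"
    using q step by (subst sum.atMost_Suc_shift) (auto simp: numeral_2_eq_2)
  also have "\<dots> = (T 0 + (\<Sum>r\<le>M. T (Suc r))) + q ^ M * z * (\<Sum>r\<le>M. T r)"
    using q by (simp add: T_def sum.distrib sum_distrib_left numeral_2_eq_2)
  also have "T 0 + (\<Sum>r\<le>M. T (Suc r)) = (\<Sum>r\<le>Suc M. T r)"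
    by (rule sum.atMost_Suc_shift [symmetric])
  also have "\<dots> = (\<Sum>r\<le>M. T r)"
    by (simp add: T_def qbinomial_def)
  also have "(\<Sum>r\<le>M. T r) = (\<Prod>i<M. 1 + q ^ i * z)"
    using Suc.IH by (simp add: T_def)
  finally show ?case by (simp add: algebra_simps)
qed

text \<open>The q-binomial theorem with 2N factors, recentred at the middle. Writing q = exp(2 s)
  makes half-integral powers of q available as powers of exp(s).\<close>

lemma finite_jacobi_triple_product:
  fixes s u :: complex
  assumes s: "Re s < 0"
  shows "(\<Prod>j<N. (1 + exp (of_nat (2 * j + 1) * s + u)) * (1 + exp (of_nat (2 * j + 1) * s - u))) =
         (\<Sum>n\<in>{- int N..int N}. qbinomial (exp (2 * s)) (2 * N) (nat (n + int N)) * gauss_term s u 0 n)"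
proof -
  define q where "q = exp (2 * s)"
  \<comment> \<open>This is e^u q^(1/2 - N): the exponents of q in the 2N factors then run
    symmetrically from 1/2 - N to N - 1/2.\<close>
  define z where "z = exp (u + (1 - 2 * of_nat N) * s)"
  have q: "norm q < 1" using s by (simp add: q_def)
  define C where "C = exp (of_nat N * u - (of_nat N)\<^sup>2 * s)"
  have gt: "q ^ i * z = exp (of_nat (2 * i) * s + u + (1 - 2 * of_nat N) * s)" for i
    unfolding q_def z_def
    by (simp flip: exp_of_nat_mult exp_add add: algebra_simps)
  have "(\<Prod>i<2 * N. 1 + q ^ i * z) = (\<Prod>i<N. 1 + q ^ i * z) * (\<Prod>i<N. 1 + q ^ (i + N) * z)"
  proof -
    have "(\<Prod>i\<in>{0..<N + N}. 1 + q ^ i * z) = (\<Prod>i\<in>{0..<N}. 1 + q ^ i * z) * (\<Prod>i\<in>{0 + N..<N + N}. 1 + q ^ i * z)"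
      by (simp add: prod.atLeastLessThan_concat)
    thus ?thesis
      unfolding prod.shift_bounds_nat_ivl by (simp add: atLeast0LessThan mult_2)
  qed
  also have "(\<Prod>i<N. 1 + q ^ (i + N) * z) = (\<Prod>j<N. 1 + exp (of_nat (2 * j + 1) * s + u))"
    by (intro prod.cong refl, simp only: gt) (simp add: algebra_simps)
  also have "(\<Prod>i<N. 1 + q ^ i * z) = (\<Prod>j<N. 1 + q ^ (N - Suc j) * z)"
    by (rule prod.nat_diff_reindex [symmetric])
  \<comment> \<open>The factors with negative powers of q are turned round by 1 + X = X (1 + 1/X).
    The extracted monomials multiply to \<open>C\<close>.\<close>
  also have "\<dots> = (\<Prod>j<N. exp (u - of_nat (2 * j + 1) * s) * (1 + exp (of_nat (2 * j + 1) * s - u)))"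
  proof (intro prod.cong refl)
    fix j assume "j \<in> {..<N}"
    hence "of_nat (N - Suc j) = (of_nat N - 1 - of_nat j :: complex)"
      by (simp add: of_nat_diff)
    hence "q ^ (N - Suc j) * z = exp (u - of_nat (2 * j + 1) * s)"
      by (simp only: gt of_nat_mult) (simp add: algebra_simps)
    thus "1 + q ^ (N - Suc j) * z = exp (u - of_nat (2 * j + 1) * s) * (1 + exp (of_nat (2 * j + 1) * s - u))"
      by (simp add: ring_distribs add.commute flip: exp_add)
  qed
  also have "\<dots> = C * (\<Prod>j<N. 1 + exp (of_nat (2 * j + 1) * s - u))"
  proof -
    have "(\<Sum>j<N. u - of_nat (2 * j + 1) * s) = of_nat N * u - (of_nat N)\<^sup>2 * s"
      by (induction N) (auto simp: algebra_simps power2_eq_square)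
    thus ?thesis
      by (simp add: prod.distrib C_def flip: exp_sum)
  qed
  finally have "(\<Prod>i<2 * N. 1 + q ^ i * z) =
      C * (\<Prod>j<N. (1 + exp (of_nat (2 * j + 1) * s + u)) * (1 + exp (of_nat (2 * j + 1) * s - u)))"
    by (simp add: prod.distrib mult_ac)
  hence "C * (\<Prod>j<N. (1 + exp (of_nat (2 * j + 1) * s + u)) * (1 + exp (of_nat (2 * j + 1) * s - u))) =
      (\<Sum>r\<le>2 * N. qbinomial q (2 * N) r * q ^ (r choose 2) * z ^ r)"
    using qbinomial_theorem [OF q, of z "2 * N"] by simp
  also have "\<dots> = (\<Sum>r\<le>2 * N. C * (qbinomial q (2 * N) r * gauss_term s u 0 (int r - int N)))"
  proof (intro sum.cong refl)
    \<comment> \<open>Completing the square: r (r - 1) s + r (u + (1 - 2N) s) = s n^2 + u n + (N u -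
      N^2 s) with n = r - N, and the last bracket is the exponent of \<open>C\<close>.\<close>
    fix r
    have "2 * of_nat (r choose 2) = (of_nat r * (of_nat r - 1) :: complex)"
      by (induction r) (auto simp: numeral_2_eq_2 algebra_simps)
    moreover have "q ^ (r choose 2) = exp (2 * of_nat (r choose 2) * s)"
      using exp_of_nat_mult [of "r choose 2" "2 * s"] by (simp add: q_def mult_ac)
    ultimately have "q ^ (r choose 2) = exp (of_nat r * (of_nat r - 1) * s)"
      by simp
    moreover have "z ^ r = exp (of_nat r * (u + (1 - 2 * of_nat N) * s))"
      by (simp add: z_def flip: exp_of_nat_mult)
    ultimately have "q ^ (r choose 2) * z ^ r = C * gauss_term s u 0 (int r - int N)"
      by (simp add: C_def gauss_term_def power2_eq_square algebra_simps flip: exp_add)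
    thus "qbinomial q (2 * N) r * q ^ (r choose 2) * z ^ r = C * (qbinomial q (2 * N) r * gauss_term s u 0 (int r - int N))"
      by (simp add: mult_ac)
  qed
  also have "\<dots> = C * (\<Sum>r\<le>2 * N. qbinomial q (2 * N) r * gauss_term s u 0 (int r - int N))"
    by (simp add: sum_distrib_left)
  also have "(\<Sum>r\<le>2 * N. qbinomial q (2 * N) r * gauss_term s u 0 (int r - int N)) =
      (\<Sum>n\<in>{- int N..int N}. qbinomial q (2 * N) (nat (n + int N)) * gauss_term s u 0 n)"
    by (rule sum.reindex_bij_witness [of _ "\<lambda>n. nat (n + int N)" "\<lambda>r. int r - int N"]) auto
  finally show ?thesis
    by (simp add: C_def q_def)
qed

text \<open>For fixed n both lower indices, N + n and N - n, tend to infinity, so the quotient tends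
  to \<phi> / (\<phi> \<phi>).\<close>

lemma tendsto_qbinomial_middle:
  assumes q: "norm q < 1" and \<phi>: "\<phi> \<noteq> 0" "qpoch q \<longlonglongrightarrow> \<phi>"
  shows "(\<lambda>N. qbinomial q (2 * N) (nat (n + int N))) \<longlonglongrightarrow> 1 / \<phi>"
proof -
  have lim: "filterlim (\<lambda>N. nat (n + int N)) at_top sequentially"
            "filterlim (\<lambda>N. nat (int N - n)) at_top sequentially"
            "filterlim (\<lambda>N::nat. 2 * N) at_top sequentially"
  proof -
    have ge: "\<forall>\<^sub>F N in sequentially. nat \<bar>n\<bar> + Z \<le> N" for Z by (rule eventually_ge_at_top)
    have "\<forall>\<^sub>F N in sequentially. Z \<le> nat (n + int N)" "\<forall>\<^sub>F N in sequentially. Z \<le> nat (int N - n)"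
        "\<forall>\<^sub>F N in sequentially. Z \<le> 2 * N" for Z
      by - (rule eventually_mono [OF ge [of Z]], linarith)+
    thus "filterlim (\<lambda>N. nat (n + int N)) at_top sequentially"
            "filterlim (\<lambda>N. nat (int N - n)) at_top sequentially"
            "filterlim (\<lambda>N::nat. 2 * N) at_top sequentially"
      unfolding filterlim_at_top by blast+
  qed
  have "(\<lambda>N. qpoch q (2 * N) / (qpoch q (nat (n + int N)) * qpoch q (nat (int N - n)))) \<longlonglongrightarrow> \<phi> / (\<phi> * \<phi>)"
    using \<phi> by (intro tendsto_divide tendsto_mult filterlim_compose [OF \<phi>(2)] lim) auto
  moreover have "\<forall>\<^sub>F N in sequentially. qpoch q (2 * N) / (qpoch q (nat (n + int N)) * qpoch q (nat (int N - n))) =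
      qbinomial q (2 * N) (nat (n + int N))"
    using eventually_ge_at_top [of "nat \<bar>n\<bar>"]
  proof eventually_elim
    case (elim N)
    hence "nat (n + int N) \<le> 2 * N" "2 * N - nat (n + int N) = nat (int N - n)" by linarith+
    thus ?case by (simp add: qbinomial_def)
  qed
  ultimately show ?thesis
    using \<phi> by (simp add: Lim_transform_eventually)
qed

text \<open>The q-factorials converge to a nonzero limit, so they and their inverses are bounded.
  The bound is uniform in both indices, as the dominated limit in the triple product needs.\<close>

lemma qbinomial_bounded:
  assumes q: "norm q < 1"
  obtains K where "\<And>M r. norm (qbinomial q M r) \<le> K"
proof -
  obtain \<phi> where \<phi>: "\<phi> \<noteq> 0" "qpoch q \<longlonglongrightarrow> \<phi>" using qpoch_limit [OF q] .
  obtain A where A: "\<And>N. norm (qpoch q N) \<le> A"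
    using \<phi>(2) by (meson BseqE convergentI convergent_imp_Bseq)
  have "(\<lambda>N. inverse (qpoch q N)) \<longlonglongrightarrow> inverse \<phi>"
    using \<phi> by (intro tendsto_inverse)
  then obtain B where B: "\<And>N. norm (inverse (qpoch q N)) \<le> B"
    by (meson BseqE convergentI convergent_imp_Bseq)
  have AB: "A \<ge> 0" "B \<ge> 0" using order_trans [OF norm_ge_zero A] order_trans [OF norm_ge_zero B] by auto
  have "norm (qbinomial q M r) \<le> A * (B * B)" for M r
  proof (cases "r \<le> M")
    case True
    have "norm (qbinomial q M r) = norm (qpoch q M) * (norm (inverse (qpoch q r)) * norm (inverse (qpoch q (M - r))))"
      using True by (simp add: qbinomial_def norm_mult norm_divide norm_inverse field_simps)
    also have "\<dots> \<le> A * (B * B)"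
      using A B AB by (intro mult_mono) auto
    finally show ?thesis .
  qed (use AB in \<open>simp add: qbinomial_def\<close>)
  thus ?thesis using that by blast
qed

text \<open>Termwise limit of the finite identity: every coefficient tends to 1/\<phi>, and the
  remaining factors 1 - q^(j + 1) have partial products tending to \<phi>, which cancels it.\<close>

theorem jacobi_triple_product:
  fixes s u :: complex
  assumes s: "Re s < 0"
  shows "(\<lambda>N. \<Prod>j<N. (1 - exp (of_nat (2 * j + 2) * s)) *
            ((1 + exp (of_nat (2 * j + 1) * s + u)) * (1 + exp (of_nat (2 * j + 1) * s - u))))
         \<longlonglongrightarrow> (\<Sum>\<^sub>\<infinity>n. gauss_term s u 0 n)"
proof -
  define q where "q = exp (2 * s)"
  have q: "norm q < 1" using s by (simp add: q_def)
  obtain \<phi> where \<phi>: "\<phi> \<noteq> 0" "qpoch q \<longlonglongrightarrow> \<phi>" using qpoch_limit [OF q] .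
  obtain K where K: "\<And>M r. norm (qbinomial q M r) \<le> K" using qbinomial_bounded [OF q] by blast
  have K0: "K \<ge> 0" using order_trans [OF norm_ge_zero K] .
  \<comment> \<open>Extension by zero turns the sums over growing intervals into sums over all
    integers, to which dominated convergence applies.\<close>
  define f where "f n N = (if n \<in> {- int N..int N} then qbinomial q (2 * N) (nat (n + int N)) * gauss_term s u 0 n else 0)" for n N
  have "(\<lambda>N. \<Sum>\<^sub>\<infinity>n. f n N) \<longlonglongrightarrow> (\<Sum>\<^sub>\<infinity>n. 1 / \<phi> * gauss_term s u 0 n)"
  proof (rule infsum_dominated_convergence)
    fix n
    have "(\<lambda>N. qbinomial q (2 * N) (nat (n + int N)) * gauss_term s u 0 n) \<longlonglongrightarrow> 1 / \<phi> * gauss_term s u 0 n"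
      by (intro tendsto_mult tendsto_const tendsto_qbinomial_middle q \<phi>)
    moreover have "\<forall>\<^sub>F N in sequentially. qbinomial q (2 * N) (nat (n + int N)) * gauss_term s u 0 n = f n N"
      using eventually_ge_at_top [of "nat \<bar>n\<bar>"] by eventually_elim (auto simp: f_def)
    ultimately show "f n \<longlonglongrightarrow> 1 / \<phi> * gauss_term s u 0 n"
      by (rule Lim_transform_eventually)
  next
    show "norm (f n N) \<le> K * norm (gauss_term s u 0 n)" for n N
      using K K0 by (auto simp: f_def norm_mult intro: mult_right_mono)
  next
    show "(\<lambda>n. K * norm (gauss_term s u 0 n)) summable_on UNIV"
      by (intro summable_on_cmult_right gauss_term_abs_summable_on s)
  qed auto
  moreover have "(\<Sum>\<^sub>\<infinity>n. f n N) =
      (\<Prod>j<N. (1 + exp (of_nat (2 * j + 1) * s + u)) * (1 + exp (of_nat (2 * j + 1) * s - u)))" for N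
  proof -
    have "(\<Sum>\<^sub>\<infinity>n. f n N) = (\<Sum>\<^sub>\<infinity>n\<in>{- int N..int N}. f n N)"
      by (rule infsum_cong_neutral) (auto simp: f_def)
    also have "\<dots> = (\<Sum>n\<in>{- int N..int N}. f n N)" by simp
    also have "\<dots> = (\<Sum>n\<in>{- int N..int N}. qbinomial q (2 * N) (nat (n + int N)) * gauss_term s u 0 n)"
      by (intro sum.cong) (auto simp: f_def)
    finally show ?thesis
      unfolding q_def finite_jacobi_triple_product [OF s] .
  qed
  ultimately have "(\<lambda>N. qpoch q N * (\<Prod>j<N. (1 + exp (of_nat (2 * j + 1) * s + u)) * (1 + exp (of_nat (2 * j + 1) * s - u))))
      \<longlonglongrightarrow> \<phi> * (\<Sum>\<^sub>\<infinity>n. 1 / \<phi> * gauss_term s u 0 n)"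
    by (intro tendsto_mult \<phi>(2)) simp
  also have "\<phi> * (\<Sum>\<^sub>\<infinity>n. 1 / \<phi> * gauss_term s u 0 n) = (\<Sum>\<^sub>\<infinity>n. gauss_term s u 0 n)"
    using \<phi>(1) by (subst infsum_cmult_right) (auto intro: gauss_term_summable_on s)
  finally have "(\<lambda>N. qpoch q N * (\<Prod>j<N. (1 + exp (of_nat (2 * j + 1) * s + u)) * (1 + exp (of_nat (2 * j + 1) * s - u))))
      \<longlonglongrightarrow> (\<Sum>\<^sub>\<infinity>n. gauss_term s u 0 n)" .
  moreover have "q ^ Suc j = exp (of_nat (2 * j + 2) * s)" for j
    unfolding q_def by (simp flip: exp_of_nat_mult exp_add add: algebra_simps)
  ultimately show ?thesis
    unfolding qpoch_def by (simp only: prod.distrib)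
qed

section \<open>Andrews-Bressoud series\<close>

text \<open>The triple product at s = pi i t and u = 2 pi i t x + pi i. The summand pi i supplies
  (-1)^n in the series and the minus signs in the product; the factor in front completes the square
  (n + x)^2.\<close>

lemma theta_half_product:
  assumes t: "Im t > 0"
  shows "(\<lambda>N. exp (of_real pi * \<i> * t * (of_real x)\<^sup>2) *
     (\<Prod>j<N. (1 - exp (of_nat (2 * j + 2) * (of_real pi * \<i> * t))) *
       ((1 - exp (of_nat (2 * j + 1) * (of_real pi * \<i> * t) + 2 * of_real pi * \<i> * t * of_real x)) *
        (1 - exp (of_nat (2 * j + 1) * (of_real pi * \<i> * t) - 2 * of_real pi * \<i> * t * of_real x)))))
     \<longlonglongrightarrow> theta x (1/2) t"
proof -
  define s where "s = of_real pi * \<i> * t"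
  define v where "v = 2 * of_real pi * \<i> * t * of_real x"
  define u where "u = v + of_real pi * \<i>"
  have s: "Re s < 0" using t by (simp add: s_def)
  have e: "exp (z + u) = - exp (z + v)" "exp (z - u) = - exp (z - v)" for z
    by (simp_all add: u_def exp_add exp_diff)
  have "(\<lambda>N. \<Prod>j<N. (1 - exp (of_nat (2 * j + 2) * s)) *
            ((1 - exp (of_nat (2 * j + 1) * s + v)) * (1 - exp (of_nat (2 * j + 1) * s - v))))
         \<longlonglongrightarrow> (\<Sum>\<^sub>\<infinity>n. gauss_term s u 0 n)"
    using jacobi_triple_product [OF s, of u] unfolding e by simp
  hence "(\<lambda>N. exp (s * (of_real x)\<^sup>2) * (\<Prod>j<N. (1 - exp (of_nat (2 * j + 2) * s)) *
            ((1 - exp (of_nat (2 * j + 1) * s + v)) * (1 - exp (of_nat (2 * j + 1) * s - v)))))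
         \<longlonglongrightarrow> exp (s * (of_real x)\<^sup>2) * (\<Sum>\<^sub>\<infinity>n. gauss_term s u 0 n)"
    by (intro tendsto_mult tendsto_const)
  also have "exp (s * (of_real x)\<^sup>2) * (\<Sum>\<^sub>\<infinity>n. gauss_term s u 0 n) =
      (\<Sum>\<^sub>\<infinity>n. exp (s * (of_real x)\<^sup>2) * gauss_term s u 0 n)"
    by (rule infsum_cmult_right' [symmetric])
  also have "\<dots> = theta x (1/2) t"
    unfolding theta_conv_gauss_sum
    by (intro infsum_cong)
       (simp add: gauss_term_def s_def u_def v_def algebra_simps flip: exp_add)
  finally show ?thesis by (simp only: s_def v_def)
qed

text \<open>For modulus 3 and shift 1/6 the three families of factors have exponents 3j + 3, 3j + 2
  and 3j + 1, so they interleave to one product over all exponents. The factor in front becomes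
  q^(1/24).\<close>

lemma eta_theta_qpoch:
  assumes w: "Im w > 0"
  obtains \<phi> where "\<phi> \<noteq> 0" "qpoch (exp (2 * of_real pi * \<i> * w)) \<longlonglongrightarrow> \<phi>"
    "theta (1/6) (1/2) (3 * w) = exp (of_real pi * \<i> * w / 12) * \<phi>"
proof -
  define q where "q = exp (2 * of_real pi * \<i> * w)"
  have q: "norm q < 1" using w by (simp add: q_def)
  obtain \<phi> where \<phi>: "\<phi> \<noteq> 0" "qpoch q \<longlonglongrightarrow> \<phi>" using qpoch_limit [OF q] .
  have q_pow: "q ^ n = exp (of_nat n * (2 * of_real pi * \<i> * w))" for n
    by (simp only: q_def exp_of_nat_mult)
  have e: "exp (of_nat (2 * j + 2) * (of_real pi * \<i> * (3 * w))) = q ^ Suc (3 * j + 2)"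
     "exp (of_nat (2 * j + 1) * (of_real pi * \<i> * (3 * w)) + 2 * of_real pi * \<i> * (3 * w) * of_real (1/6)) = q ^ Suc (3 * j + 1)"
     "exp (of_nat (2 * j + 1) * (of_real pi * \<i> * (3 * w)) - 2 * of_real pi * \<i> * (3 * w) * of_real (1/6)) = q ^ Suc (3 * j)" for j
    unfolding q_pow by (rule arg_cong [of _ _ exp]; simp add: field_simps)+
  have prod: "(\<Prod>j<N. (1 - q ^ Suc (3 * j + 2)) * ((1 - q ^ Suc (3 * j + 1)) * (1 - q ^ Suc (3 * j)))) = qpoch q (3 * N)" for N
  proof (induction N)
    case (Suc N)
    have "qpoch q (3 * Suc N) = qpoch q (Suc (Suc (Suc (3 * N))))"
      by (rule arg_cong [of _ _ "qpoch q"]) simp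
    also have "\<dots> = qpoch q (3 * N) * ((1 - q ^ Suc (3 * N + 2)) * ((1 - q ^ Suc (3 * N + 1)) * (1 - q ^ Suc (3 * N))))"
      unfolding qpoch_Suc by (simp only: mult_ac add_2_eq_Suc' add_Suc_right One_nat_def add_0_right)
    finally show ?case unfolding prod.lessThan_Suc Suc.IH ..
  qed simp
  have "(\<lambda>N. exp (of_real pi * \<i> * (3 * w) * (of_real (1/6))\<^sup>2) * qpoch q (3 * N)) \<longlonglongrightarrow> theta (1/6) (1/2) (3 * w)"
    using theta_half_product [of "3 * w" "1/6"] w unfolding e prod by simp
  moreover have "filterlim (\<lambda>N::nat. 3 * N) at_top sequentially"
    by (rule filterlim_subseq) (simp add: strict_mono_def)
  hence "(\<lambda>N. exp (of_real pi * \<i> * (3 * w) * (of_real (1/6))\<^sup>2) * qpoch q (3 * N)) \<longlonglongrightarrow>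
      exp (of_real pi * \<i> * (3 * w) * (of_real (1/6))\<^sup>2) * \<phi>"
    by (intro tendsto_mult tendsto_const filterlim_compose [OF \<phi>(2)])
  ultimately have "theta (1/6) (1/2) (3 * w) = exp (of_real pi * \<i> * (3 * w) * (of_real (1/6))\<^sup>2) * \<phi>"
    using LIMSEQ_unique by blast
  moreover have "of_real pi * \<i> * (3 * w) * (of_real (1/6))\<^sup>2 = of_real pi * \<i> * w / 12"
    by (simp add: power2_eq_square)
  ultimately show ?thesis using that \<phi> by (simp only: q_def)
qed

lemma convergent_prod_one_minus_powi:
  fixes q :: complex and e :: "nat \<Rightarrow> int"
  assumes q: "norm q < 1" and e: "\<And>n. e n \<ge> int (Suc n)"
  shows "convergent_prod (\<lambda>n. 1 - q powi e n)"
proof -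
  have "norm (q powi e n) \<le> norm q ^ n" for n
  proof -
    have "q powi e n = q ^ nat (e n)" using e [of n] by (simp add: power_int_def)
    moreover have "norm q ^ nat (e n) \<le> norm q ^ n"
      using q e [of n] by (intro power_decreasing) auto
    ultimately show ?thesis by (simp add: norm_power)
  qed
  hence "summable (\<lambda>n. norm (q powi e n))"
    using q by (intro summable_comparison_test' [OF summable_geometric [of "norm q"]]) auto
  hence "summable (\<lambda>n. norm ((1 - q powi e n) - 1))" by simp
  thus ?thesis
    using abs_convergent_prod_conv_summable abs_convergent_prod_imp_convergent_prod by blast
qed

text \<open>With t = 2 k w and x = (j - 1)/(2k) the triple product has the exponents 2k m and (2m -
  1) k \<plusminus> (j - 1), which are those of the numerator. The identity is proved for partial
  products and carried to the limit.\<close>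

theorem andrews_bressoud_eq_theta_quotient:
  assumes j: "j \<in> {1..k}"
  shows "andrews_bressoud k j \<tau> =
     theta (of_nat (j - 1) / of_nat (2 * k)) (1/2) (of_nat (2 * k) * Rep_uhp \<tau>) / theta (1/6) (1/2) (3 * Rep_uhp \<tau>)"
proof -
  define w where "w = Rep_uhp \<tau>"
  define q where "q = exp (2 * of_real pi * \<i> * w)"
  define r where "r = j - 1"
  define x :: real where "x = of_nat r / of_nat (2 * k)"
  define t where "t = of_nat (2 * k) * w"
  have j_eq: "int j = int r + 1" "r < k" "k > 0" using j by (auto simp: r_def)
  have w: "Im w > 0" using Rep_uhp [of \<tau>] by (simp add: w_def)
  have t: "Im t > 0" using w j_eq by (simp add: t_def)
  have q: "norm q < 1" using w by (simp add: q_def)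
  obtain \<phi> where \<phi>: "\<phi> \<noteq> 0" "qpoch q \<longlonglongrightarrow> \<phi>"
    "theta (1/6) (1/2) (3 * w) = exp (of_real pi * \<i> * w / 12) * \<phi>"
    using eta_theta_qpoch [OF w] unfolding q_def by blast
  define e1 e2 e3 where "e1 n = 2 * int k * (int n + 1)"
    and "e2 n = 2 * int k * (int n + 1) - int k - int j + 1"
    and "e3 n = 2 * int k * (int n + 1) - int k + int j - 1" for n
  define P where "P n = (1 - q powi e1 n) * (1 - q powi e2 n) * (1 - q powi e3 n) / (1 - q powi (int n + 1))" for n
  have powi: "q powi e = exp (of_int e * (2 * of_real pi * \<i> * w))" for e
    by (simp add: q_def exp_power_int mult_ac)
  \<comment> \<open>The bound j \<le> k enters here: it gives k - (j - 1) \<ge> 1, so even the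
    smallest exponent \<open>e2 n\<close> grows at least like n + 1 and convergence follows from the
    geometric series.\<close>
  have ge: "e2 n \<ge> int (Suc n)" "e1 n \<ge> int (Suc n)" "e3 n \<ge> int (Suc n)" for n
  proof -
    have "int k * int n \<ge> 1 * int n" using j_eq by (intro mult_right_mono) auto
    moreover have "e2 n = 2 * (int k * int n) + (int k - int r)" "e1 n = 2 * (int k * int n) + 2 * int k"
        "e3 n = 2 * (int k * int n) + (int k + int r)"
      by (auto simp: e1_def e2_def e3_def j_eq algebra_simps)
    ultimately show "e2 n \<ge> int (Suc n)" "e1 n \<ge> int (Suc n)" "e3 n \<ge> int (Suc n)"
      using j_eq by linarith+
  qed
  have "convergent_prod P"
    unfolding P_def
    by (intro convergent_prod_divide convergent_prod_mult convergent_prod_one_minus_powi q ge) simp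
  hence "(\<lambda>n. \<Prod>i\<le>n. P i) \<longlonglongrightarrow> prodinf P" by (rule convergent_prod_LIMSEQ)
  hence lim1: "(\<lambda>N. \<Prod>i<N. P i) \<longlonglongrightarrow> prodinf P"
    by (subst (asm) LIMSEQ_lessThan_iff_atMost [symmetric, where f = "\<lambda>S. \<Prod>i\<in>S. P i"])
  have e: "exp (of_nat (2 * n + 2) * (of_real pi * \<i> * t)) = q powi e1 n"
     "exp (of_nat (2 * n + 1) * (of_real pi * \<i> * t) + 2 * of_real pi * \<i> * t * of_real x) = q powi e3 n"
     "exp (of_nat (2 * n + 1) * (of_real pi * \<i> * t) - 2 * of_real pi * \<i> * t * of_real x) = q powi e2 n" for n
    unfolding powi using j_eq
    by (intro arg_cong [of _ _ exp]; simp add: t_def x_def e1_def e2_def e3_def field_simps)+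
  define C where "C = exp (of_real pi * \<i> * t * (of_real x)\<^sup>2)"
  have "(\<lambda>N. C * (\<Prod>n<N. (1 - q powi e1 n) * ((1 - q powi e3 n) * (1 - q powi e2 n))))
     \<longlonglongrightarrow> theta x (1/2) t"
    using theta_half_product [OF t, of x] unfolding e C_def .
  hence "(\<lambda>N. C * (\<Prod>n<N. (1 - q powi e1 n) * ((1 - q powi e3 n) * (1 - q powi e2 n))) / qpoch q N)
     \<longlonglongrightarrow> theta x (1/2) t / \<phi>"
    by (intro tendsto_divide \<phi>)
  moreover have "C * (\<Prod>n<N. (1 - q powi e1 n) * ((1 - q powi e3 n) * (1 - q powi e2 n))) / qpoch q N = C * (\<Prod>i<N. P i)" for N
  proof -
    have "q powi (int n + 1) = q ^ Suc n" for n
      using power_int_of_nat [of q "Suc n"] by (simp add: add.commute)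
    thus ?thesis by (simp add: P_def qpoch_def prod_dividef prod.distrib mult_ac)
  qed
  ultimately have "(\<lambda>N. C * (\<Prod>i<N. P i)) \<longlonglongrightarrow> theta x (1/2) t / \<phi>" by simp
  moreover have "(\<lambda>N. C * (\<Prod>i<N. P i)) \<longlonglongrightarrow> C * prodinf P"
    by (intro tendsto_mult tendsto_const lim1)
  ultimately have CP: "C * prodinf P = theta x (1/2) t / \<phi>"
    using LIMSEQ_unique by blast
  \<comment> \<open>The exponent equals (j - 1)^2 / (4k) - 1/24: the first part is the prefactor of
    the numerator theta series, the second that of eta.\<close>
  have qp: "q_pow (andrews_bressoud_exponent k j) \<tau> = C / exp (of_real pi * \<i> * w / 12)"
  proof -
    have "(of_nat j :: complex) = of_nat r + 1" using j_eq by (metis of_int_add of_int_of_nat_eq of_int_1)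
    hence "of_rat (andrews_bressoud_exponent k j) = (of_nat r)\<^sup>2 / (4 * of_nat k) - (1 / 24 :: complex)"
      using j_eq unfolding andrews_bressoud_exponent_def
      by (simp add: of_rat_divide of_rat_mult of_rat_diff of_rat_add of_rat_power power2_eq_square divide_simps)
         (simp add: algebra_simps)
    moreover have "of_real pi * \<i> * t * (of_real x)\<^sup>2 = 2 * of_real pi * \<i> * ((of_nat r)\<^sup>2 / (4 * of_nat k)) * w"
      using j_eq by (simp add: t_def x_def power2_eq_square divide_simps)
    ultimately have "2 * of_real pi * \<i> * of_rat (andrews_bressoud_exponent k j) * w =
        of_real pi * \<i> * t * (of_real x)\<^sup>2 - of_real pi * \<i> * w / 12"
      by (simp only: ring_distribs) simp
    thus ?thesis
      unfolding q_pow_def C_def exp_diff [symmetric] w_def [symmetric] by (rule arg_cong)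
  qed
  have "andrews_bressoud k j \<tau> = q_pow (andrews_bressoud_exponent k j) \<tau> * prodinf P"
    unfolding andrews_bressoud_def Let_def P_def e1_def e2_def e3_def q_def w_def ..
  also have "\<dots> = (theta x (1/2) t / \<phi>) / exp (of_real pi * \<i> * w / 12)"
    unfolding qp CP [symmetric] by simp
  also have "\<dots> = theta x (1/2) t / theta (1/6) (1/2) (3 * w)"
    unfolding \<phi>(3) by simp
  finally show ?thesis by (simp only: x_def t_def r_def w_def)
qed

section \<open>Invariance of the span\<close>

abbreviation (input) bressoud_space :: "nat \<Rightarrow> (uhp \<Rightarrow> complex) set" where
  "bressoud_space k \<equiv> uhp_fun.span (andrews_bressoud k ` {1..k})"

text \<open>For s < k the quotient is the generator with index s + 1. For s > k reflection leads to
  2k - s < k, and for s = k it makes the quotient its own negative.\<close>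

lemma theta_quotient_in_bressoud_space:
  assumes s: "s < 2 * k"
  shows "(\<lambda>\<tau>. theta (of_nat s / of_nat (2 * k)) (1/2) (of_nat (2 * k) * Rep_uhp \<tau>) / theta (1/6) (1/2) (3 * Rep_uhp \<tau>))
     \<in> bressoud_space k"
proof -
  define F where "F s = (\<lambda>\<tau>. theta (of_nat s / of_nat (2 * k)) (1/2) (of_nat (2 * k) * Rep_uhp \<tau>) / theta (1/6) (1/2) (3 * Rep_uhp \<tau>))" for s
  have small: "F s \<in> bressoud_space k" if "s < k" for s
  proof -
    have "F s = andrews_bressoud k (s + 1)"
      unfolding F_def using that by (intro ext) (simp add: andrews_bressoud_eq_theta_quotient)
    thus ?thesis using that by (auto intro: uhp_fun.span_base)
  qed
  have refl: "F (2 * k - s) = uhp_scale (- 1) (F s)" if "s \<le> 2 * k" "k > 0" for s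
  proof -
    have "real (2 * k - s) / real (2 * k) = 1 - real s / real (2 * k)"
      using that by (simp add: of_nat_diff field_simps)
    thus ?thesis unfolding F_def uhp_scale_def by (intro ext) (simp only: theta_half_reflect, simp)
  qed
  have "F s \<in> bressoud_space k"
  proof -
    consider "s < k" | "s = k" | "s > k" by linarith
    thus ?thesis
    proof cases
      case 2
      have "F k = uhp_scale (- 1) (F k)" using refl [of k] 2 s by simp
      hence "F k = 0" by (auto simp: fun_eq_iff uhp_scale_def)
      thus ?thesis using 2 by (simp add: uhp_fun.span_zero)
    next
      case 3
      have "F (2 * k - (2 * k - s)) = uhp_scale (- 1) (F (2 * k - s))"
        using 3 s by (intro refl) auto
      moreover have "F (2 * k - s) \<in> bressoud_space k" using 3 s by (intro small) auto
      ultimately show ?thesis using s by (metis diff_diff_cancel less_imp_le uhp_fun.span_scale)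
    qed (rule small)
  qed
  thus ?thesis by (simp only: F_def)
qed

lemma bressoud_space_comp:
  assumes gen: "\<And>j. j \<in> {1..k} \<Longrightarrow> (\<lambda>\<tau>. andrews_bressoud k j (g \<tau>)) \<in> bressoud_space k"
    and f: "f \<in> bressoud_space k"
  shows "(\<lambda>\<tau>. f (g \<tau>)) \<in> bressoud_space k"
  using f
proof (induction rule: uhp_fun.span_induct_alt)
  case base
  have "(\<lambda>\<tau>. (0 :: uhp \<Rightarrow> complex) (g \<tau>)) = 0" by (simp add: fun_eq_iff)
  thus ?case by (simp only: uhp_fun.span_zero)
next
  case (step c f h)
  have "(\<lambda>\<tau>. f (g \<tau>)) \<in> bressoud_space k" using step(1) gen by auto
  moreover have "(\<lambda>\<tau>. (uhp_scale c f + h) (g \<tau>)) = uhp_scale c (\<lambda>\<tau>. f (g \<tau>)) + (\<lambda>\<tau>. h (g \<tau>))"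
    by (simp add: fun_eq_iff uhp_scale_def)
  ultimately show ?case
    using step(2) by (simp only: uhp_fun.span_add uhp_fun.span_scale)
qed

text \<open>Each generator is an eigenfunction, since both theta series are multiplied by roots of
  unity.\<close>

lemma bressoud_space_translate:
  fixes n :: int
  assumes g: "\<And>\<tau>. Rep_uhp (g \<tau>) = Rep_uhp \<tau> + of_int n" and f: "f \<in> bressoud_space k"
  shows "(\<lambda>\<tau>. f (g \<tau>)) \<in> bressoud_space k"
  using _ f
proof (rule bressoud_space_comp)
  fix j assume j: "j \<in> {1..k}"
  define c where "c = exp (2 * of_real pi * \<i> * of_int n * (of_int (int (j - 1)))\<^sup>2 / of_nat (4 * k)) / exp (of_real pi * \<i> * of_int n / 12)"
  have "(\<lambda>\<tau>. andrews_bressoud k j (g \<tau>)) = uhp_scale c (andrews_bressoud k j)"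
  proof
    fix \<tau>
    have "andrews_bressoud k j (g \<tau>) =
       theta (of_int (int (j - 1)) / of_nat (2 * k)) (1/2) (of_nat (2 * k) * (Rep_uhp \<tau> + of_int n)) /
       theta (1/6) (1/2) (3 * (Rep_uhp \<tau> + of_int n))"
      by (simp only: andrews_bressoud_eq_theta_quotient [OF j] g of_int_of_nat_eq)
    also have "\<dots> = c * andrews_bressoud k j \<tau>"
      unfolding eta_theta_translate
      by (subst theta_family_translate) (use j in \<open>auto simp: c_def andrews_bressoud_eq_theta_quotient\<close>)
    finally show "andrews_bressoud k j (g \<tau>) = uhp_scale c (andrews_bressoud k j) \<tau>"
      by (simp add: uhp_scale_def)
  qed
  thus "(\<lambda>\<tau>. andrews_bressoud k j (g \<tau>)) \<in> bressoud_space k"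
    by (simp only:) (intro uhp_fun.span_scale uhp_fun.span_base imageI j)
qed

lemma sum_apply: "(\<Sum>s\<in>I. f s) x = (\<Sum>s\<in>I. f s x)"
  by (induction I rule: infinite_finite_induct) auto

text \<open>Numerator and denominator acquire the same factor \<open>J\<close>. Only
  \<open>J\<close> \<noteq> 0 matters for cancelling it, so no relation between the two branches of
  the square root has to be worked out.\<close>

lemma bressoud_space_lower_triangular:
  fixes n :: int
  assumes g: "\<And>\<tau>. Rep_uhp (g \<tau>) = Rep_uhp \<tau> / (1 + 2 * of_int n * Rep_uhp \<tau>)" and f: "f \<in> bressoud_space k"
  shows "(\<lambda>\<tau>. f (g \<tau>)) \<in> bressoud_space k"
  using _ f
proof (rule bressoud_space_comp)
  fix j assume j: "j \<in> {1..k}"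
  define M where "M = 2 * k"
  have M: "M > 0" using j by (auto simp: M_def)
  define c where "c = exp (- of_real pi * \<i> * of_int n / 6)"
  define F where "F s = (\<lambda>\<tau>. theta (of_nat s / of_nat M) (1/2) (of_nat M * Rep_uhp \<tau>) / theta (1/6) (1/2) (3 * Rep_uhp \<tau>))" for s :: nat
  obtain u where u: "\<And>w. Im w > 0 \<Longrightarrow> theta (of_int (int (j - 1)) / of_nat M) (1/2) (of_nat M * (w / (1 + 2 * of_int n * w))) =
     csqrt (- \<i> * w) / csqrt (- \<i> * (w / (1 + 2 * of_int n * w))) * (\<Sum>s<M. u s * theta (of_nat s / of_nat M) (1/2) (of_nat M * w))"
    using theta_family_lower_triangular [OF M, of "int (j - 1)" n] by blast
  have "(\<lambda>\<tau>. andrews_bressoud k j (g \<tau>)) = (\<Sum>s<M. uhp_scale (u s / c) (F s))"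
  proof
    fix \<tau>
    define w where "w = Rep_uhp \<tau>"
    have w: "Im w > 0" using Rep_uhp [of \<tau>] by (simp add: w_def)
    define w' where "w' = w / (1 + 2 * of_int n * w)"
    define J where "J = csqrt (- \<i> * w) / csqrt (- \<i> * w')"
    have "Im w' > 0" unfolding w'_def using Im_lower_triangular [OF w] by blast
    hence "w \<noteq> 0" "w' \<noteq> 0" using w by auto
    hence J: "J \<noteq> 0" by (simp add: J_def del: csqrt.simps)
    have "andrews_bressoud k j (g \<tau>) =
       theta (of_int (int (j - 1)) / of_nat M) (1/2) (of_nat M * w') / theta (1/6) (1/2) (3 * w')"
      by (simp only: andrews_bressoud_eq_theta_quotient [OF j] g of_int_of_nat_eq M_def w_def w'_def)
    also have "\<dots> = (J * (\<Sum>s<M. u s * theta (of_nat s / of_nat M) (1/2) (of_nat M * w))) / (J * (c * theta (1/6) (1/2) (3 * w)))"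
      unfolding w'_def u [OF w] eta_theta_lower_triangular [OF w] c_def J_def ..
    also have "\<dots> = (\<Sum>s<M. u s / c * F s \<tau>)"
      using J by (simp add: F_def w_def sum_divide_distrib)
    finally show "andrews_bressoud k j (g \<tau>) = (\<Sum>s<M. uhp_scale (u s / c) (F s)) \<tau>"
      by (simp add: uhp_scale_def sum_apply)
  qed
  also have "\<dots> \<in> bressoud_space k"
  proof (intro uhp_fun.span_sum uhp_fun.span_scale)
    fix s assume "s \<in> {..<M}"
    thus "F s \<in> bressoud_space k"
      unfolding F_def M_def by (intro theta_quotient_in_bressoud_space) auto
  qed
  finally show "(\<lambda>\<tau>. andrews_bressoud k j (g \<tau>)) \<in> bressoud_space k" .
qed

text \<open>The nearest-integer quotient is needed because the second reduction of the Euclidean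
  algorithm is modulo 2a rather than a. Ordinary remainders would give only |c'| < 2|a'| with |a'| <
  |c|, which does not force a descent.\<close>

lemma centered_remainder:
  fixes a c :: int
  assumes "c \<noteq> 0"
  obtains n where "2 * \<bar>a - n * c\<bar> \<le> \<bar>c\<bar>"
proof -
  have eq: "a = a div c * c + a mod c" by simp
  show ?thesis
  proof (cases "2 * \<bar>a mod c\<bar> \<le> \<bar>c\<bar>")
    case True
    show ?thesis by (rule that [of "a div c"]) (use True eq in \<open>simp add: minus_div_mult_eq_mod\<close>)
  next
    case False
    have "a - (a div c + 1) * c = a mod c - c" by (simp add: algebra_simps minus_div_mult_eq_mod)
    moreover have "2 * \<bar>a mod c - c\<bar> \<le> \<bar>c\<bar>"
    proof -
      have "2 * \<bar>r - c\<bar> \<le> \<bar>c\<bar>"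
        if "\<not> 2 * \<bar>r\<bar> \<le> \<bar>c\<bar>" "0 < c \<and> 0 \<le> r \<and> r < c \<or> c < 0 \<and> r \<le> 0 \<and> c < r" for r
        using that by (auto simp: abs_if split: if_splits)
      moreover have "0 < c \<and> 0 \<le> a mod c \<and> a mod c < c \<or> c < 0 \<and> a mod c \<le> 0 \<and> c < a mod c"
        using assms by (cases "c > 0") auto
      ultimately show ?thesis using False by blast
    qed
    ultimately show ?thesis using that by metis
  qed
qed

text \<open>Euclidean algorithm on the first column: translations reduce \<open>a\<close> modulo \<open>c\<close>, and the maps
  \<open>\<tau> / (1 + 2 m \<tau>)\<close> then reduce \<open>c\<close> modulo \<open>2 a\<close>.\<close>

lemma bressoud_space_Gamma0_2:
  fixes a b c d :: int
  assumes "a * d - b * c = 1" "even c"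
    and "\<And>\<tau>. Rep_uhp (g \<tau>) = (of_int a * Rep_uhp \<tau> + of_int b) / (of_int c * Rep_uhp \<tau> + of_int d)"
    and "f \<in> bressoud_space k"
  shows "(\<lambda>\<tau>. f (g \<tau>)) \<in> bressoud_space k"
  using assms
proof (induction "nat \<bar>c\<bar>" arbitrary: a b c d g f rule: less_induct)
  case less
  note g = less.prems(3)
  show ?case
  proof (cases "c = 0")
    case True
    \<comment> \<open>As d is its own inverse, the map is the translation by b d.\<close>
    hence "a = d \<and> (d = 1 \<or> d = - 1)"
      using less.prems(1) by (auto simp: zmult_eq_1_iff)
    hence "Rep_uhp (g \<tau>) = Rep_uhp \<tau> + of_int (b * d)" for \<tau>
      using g [of \<tau>] True by auto
    thus ?thesis using less.prems(4) by (rule bressoud_space_translate)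
  next
    case False
    obtain n where n: "2 * \<bar>a - n * c\<bar> \<le> \<bar>c\<bar>" using centered_remainder [OF False] .
    define a' b' where "a' = a - n * c" and "b' = b - n * d"
    have det: "a' * d - b' * c = 1"
      using less.prems(1) by (simp add: a'_def b'_def algebra_simps)
    \<comment> \<open>Otherwise the determinant condition would make the even number c a
      unit.\<close>
    have "a' \<noteq> 0"
    proof
      assume "a' = 0"
      hence "c dvd 1" using det by (metis diff_0 dvd_minus_iff dvd_triv_right mult_zero_left)
      thus False using \<open>even c\<close> by (meson dvd_trans odd_one)
    qed
    then obtain m where m: "2 * \<bar>c - m * (2 * a')\<bar> \<le> \<bar>2 * a'\<bar>"
      using centered_remainder [of "2 * a'" c] by auto
    define c' d' where "c' = c - 2 * m * a'" and "d' = d - 2 * m * b'"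
    have "c' = c - m * (2 * a')" by (simp add: c'_def)
    hence "2 * \<bar>c'\<bar> \<le> 2 * \<bar>a'\<bar>" using m by (simp add: abs_mult)
    \<comment> \<open>The two centred reductions combine to |c'| \<le> |a'| \<le> |c|/2, which is
      strictly below |c| because c is nonzero.\<close>
    hence c': "nat \<bar>c'\<bar> < nat \<bar>c\<bar>"
      using n False unfolding a'_def [symmetric] by linarith
    have det': "a' * d' - b' * c' = 1"
      using det by (simp add: c'_def d'_def algebra_simps)
    \<comment> \<open>The map factors as \<open>T\<close> after \<open>U\<close> after
      \<open>g2\<close>, where \<open>g2\<close> has the matrix with entries a', b', c', d'. The
      induction hypothesis is applied to \<open>g2\<close> and to the function f composed with
      \<open>T\<close> and \<open>U\<close>, hence the induction over arbitrary f.\<close>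
    define T where "T \<tau> = Abs_uhp (Rep_uhp \<tau> + of_int n)" for \<tau>
    define U where "U \<tau> = Abs_uhp (Rep_uhp \<tau> / (1 + 2 * of_int m * Rep_uhp \<tau>))" for \<tau>
    define g1 where "g1 \<tau> = Abs_uhp (Rep_uhp (g \<tau>) - of_int n)" for \<tau>
    define g2 where "g2 \<tau> = Abs_uhp (Rep_uhp (g1 \<tau>) / (1 + 2 * of_int (- m) * Rep_uhp (g1 \<tau>)))" for \<tau>
    have Im: "Im (Rep_uhp \<tau>) > 0" for \<tau> using Rep_uhp by auto
    have T: "Rep_uhp (T \<tau>) = Rep_uhp \<tau> + of_int n" for \<tau>
      unfolding T_def using Im by (intro Abs_uhp_inverse) simp
    have U: "Rep_uhp (U \<tau>) = Rep_uhp \<tau> / (1 + 2 * of_int m * Rep_uhp \<tau>)" for \<tau>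
      unfolding U_def using Im_lower_triangular(2) [OF Im] by (intro Abs_uhp_inverse) auto
    have g1: "Rep_uhp (g1 \<tau>) = Rep_uhp (g \<tau>) - of_int n" for \<tau>
      unfolding g1_def using Im by (intro Abs_uhp_inverse) simp
    have g2: "Rep_uhp (g2 \<tau>) = Rep_uhp (g1 \<tau>) / (1 + 2 * of_int (- m) * Rep_uhp (g1 \<tau>))" for \<tau>
      unfolding g2_def using Im_lower_triangular(2) [OF Im] by (intro Abs_uhp_inverse) blast
    have g_eq: "g \<tau> = T (U (g2 \<tau>))" for \<tau>
    proof -
      have nz: "1 + 2 * of_int (- m) * Rep_uhp (g1 \<tau>) \<noteq> 0" using Im_lower_triangular(1) [OF Im] .
      have "Rep_uhp (U (g2 \<tau>)) = Rep_uhp (g1 \<tau>)"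
        unfolding U g2 using nz by (simp add: field_simps)
      hence "Rep_uhp (T (U (g2 \<tau>))) = Rep_uhp (g \<tau>)"
        by (simp add: T g1)
      thus ?thesis by (simp add: Rep_uhp_inject)
    qed
    have "Rep_uhp (g2 \<tau>) = (of_int a' * Rep_uhp \<tau> + of_int b') / (of_int c' * Rep_uhp \<tau> + of_int d')" for \<tau>
    proof -
      define w where "w = Rep_uhp \<tau>"
      have nz: "of_int c * w + of_int d \<noteq> 0"
        using Im [of \<tau>] False by (auto simp: w_def complex_eq_iff)
      have nz2: "1 + 2 * of_int (- m) * Rep_uhp (g1 \<tau>) \<noteq> 0" using Im_lower_triangular(1) [OF Im] .
      have g1': "Rep_uhp (g1 \<tau>) = (of_int a' * w + of_int b') / (of_int c * w + of_int d)"
        using nz by (simp add: g1 g w_def [symmetric] a'_def b'_def field_simps)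
      have "1 + 2 * of_int (- m) * Rep_uhp (g1 \<tau>) = (of_int c' * w + of_int d') / (of_int c * w + of_int d)"
        using nz by (simp add: g1' c'_def d'_def field_simps)
      thus ?thesis unfolding g2 using nz by (simp add: g1' w_def)
    qed
    moreover have "even c'" using \<open>even c\<close> by (simp add: c'_def)
    moreover have "(\<lambda>\<tau>. f (T \<tau>)) \<in> bressoud_space k"
      using T less.prems(4) by (rule bressoud_space_translate)
    hence "(\<lambda>\<tau>. f (T (U \<tau>))) \<in> bressoud_space k"
      using bressoud_space_lower_triangular [OF U, of "\<lambda>\<tau>. f (T \<tau>)"] by simp
    ultimately have "(\<lambda>\<tau>. f (T (U (g2 \<tau>)))) \<in> bressoud_space k"
      using less.hyps [OF c' det', of g2 "\<lambda>\<tau>. f (T (U \<tau>))"] by blast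
    thus ?thesis by (simp only: g_eq [symmetric])
  qed
qed

theorem theorem1:
  fixes k :: nat
  assumes "k \<ge> 2"
  shows "\<forall>f \<in> uhp_fun.span (andrews_bressoud k ` {1..k}). \<forall>A \<in> Gamma0_2.
           (\<lambda>\<tau>. f (moebius_uhp A \<tau>)) \<in> uhp_fun.span (andrews_bressoud k ` {1..k})"
proof (intro ballI)
  fix f A assume f: "f \<in> bressoud_space k" and A: "A \<in> Gamma0_2"
  have "det A = 1" "even (A $ 2 $ 1)" using A by (auto simp: Gamma0_2_def)
  thus "(\<lambda>\<tau>. f (moebius_uhp A \<tau>)) \<in> bressoud_space k"
    using bressoud_space_Gamma0_2 [OF _ _ Rep_moebius_uhp f] by (simp add: det_2)
qed

end
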